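(* Let $(M,\phi,\xi,\eta,g)$ be a non-Sasakian contact metric $(\kappa,\mu)$-space. The standard almost bi-paracontact structure of $M$ is given by $(\phi_1,\phi_2,\phi_3)$, where $$\phi_1:=\frac1{\sqrt{1-\kappa}}\,\phi h,\qquad \phi_2:=\frac1{\sqrt{1-\kappa}}\,h,\qquad \phi_3:=\phi .$$
   Context: Everything is smooth. A contact metric manifold $(M,\phi,\xi,\eta,g)$ is a $(2n+1)$-dimensional manifold with a $(1,1)$-tensor $\phi$, vector field $\xi$, $1$-form $\eta$ and Riemannian metric $g$ such that $\phi^2=-I+\eta\otimes\xi$, $\eta(\xi)=1$, $g(\phi X,\phi Y)=g(X,Y)-\eta(X)\eta(Y)$ and $d\eta(X,Y)=g(X,\phi Y)$, where $2d\eta(X,Y)=X(\eta(Y))-Y(\eta(X))-\eta([X,Y])$. Put $\mathcal D=\ker\eta$, $h:=\frac12\mathcal L_\xi\phi$. It is Sasakian if $[\phi,\phi]+2d\eta\otimes\xi=0$, where $[\phi,\phi](X,Y)=\phi^2[X,Y]+[\phi X,\phi Y]-\phi[\phi X,Y]-\phi[X,\phi Y]$. A contact metric $(\kappa,\mu)$-space, $\kappa,\mu\in\mathbb R$, is a contact metric manifold whose Levi-Civita curvature $R^g(X,Y)=[\nabla^g_X,\nabla^g_Y]-\nabla^g_{[X,Y]}$ satisfies $R^g(X,Y)\xi=\kappa(\eta(Y)X-\eta(X)Y)+\mu(\eta(Y)hX-\eta(X)hY)$; non-Sasakian implies $\kappa<1$; put $\lambda=\sqrt{1-\kappa}$. An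 almost bi-paracontact structure on $(M,\eta)$ is a triplet $(\phi_1,\phi_2,\phi_3)$ of $(1,1)$-tensor fields with $\phi_1\phi_2=-\phi_2\phi_1$, $\phi_1^2=\phi_2^2=I-\eta\otimes\xi$, $\phi_3=\phi_1\phi_2$, $\phi_3^2=-I+\eta\otimes\xi$. It is integrable if the $\pm1$-eigendistributions of $\phi_1$ and $\phi_2$ are Legendre foliations (involutive rank $n$ subbundles of $\mathcal D$). On a non-Sasakian contact metric $(\kappa,\mu)$-space the operators $h$ and $\phi h$ both have eigenvalues $0$ (with eigenspace $\mathbb R\xi$) and $\pm\lambda$, each with an $n$-dimensional eigendistribution, denoted $\mathcal D_h(\pm\lambda)$, $\mathcal D_{\phi h}(\pm\lambda)$; these are four Legendre foliations, those of $h$ being transversal to those of $\phi h$. The standard almost bi-paracontact structure of $M$ is the integrable almost bi-paracontact structure $(\phi_1,\phi_2,\phi_3)$ determined by these two transverse bi-Legendrian structures: $\phi_1=\pm I$ on $\mathcal D_{\phi h}(\pm\lambda)$, $\phi_1\xi=0$; $\phi_2=\pm I$ on $\mathcal D_h(\pm\lambda)$, $\phi_2\xi=0$; $\phi_3=\phi_1\phi_2$. *)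

theory Defs
  imports "HOL-Analysis.Analysis" "HOL-Library.Function_Algebras"
begin

section \<open>Real-valued functions as a real vector space\<close>

text \<open>Tangent vectors are represented as functionals on functions; the pointwise structure below
  makes \<^const>\<open>span\<close> and \<^const>\<open>independent\<close> applicable to them.\<close>

instantiation "fun" :: (type, real_vector) real_vector
begin

definition scaleR_fun :: "real \<Rightarrow> ('a \<Rightarrow> 'b) \<Rightarrow> 'a \<Rightarrow> 'b" where
  "scaleR_fun c f = (\<lambda>x. c *\<^sub>R f x)"

instance
  by standard (simp_all add: scaleR_fun_def fun_eq_iff scaleR_add_right scaleR_add_left)

end

lemma scaleR_fun_apply [simp]: "(c *\<^sub>R f) x = c *\<^sub>R f x"
  by (simp add: scaleR_fun_def)


section \<open>Smooth manifolds\<close>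

text \<open>\<open>times_differentiable_on k S f\<close>: on the open set \<open>S\<close>, \<open>f\<close> is of class \<open>C\<^sup>k\<close>.\<close>

primrec times_differentiable_on ::
    "nat \<Rightarrow> 'e::real_normed_vector set \<Rightarrow> ('e \<Rightarrow> 'f::real_normed_vector) \<Rightarrow> bool" where
  "times_differentiable_on 0 S f \<longleftrightarrow> continuous_on S f"
| "times_differentiable_on (Suc k) S f \<longleftrightarrow> f differentiable_on S \<and>
     (\<forall>v. times_differentiable_on k S (\<lambda>x. frechet_derivative f (at x) v))"

definition smooth_on :: "'e::real_normed_vector set \<Rightarrow> ('e \<Rightarrow> 'f::real_normed_vector) \<Rightarrow> bool" where
  "smooth_on S f \<longleftrightarrow> (\<forall>k. times_differentiable_on k S f)"

text \<open>A chart is a pair \<open>(U, \<psi>)\<close> of a domain and a coordinate map, only the values of which on \<open>U\<close>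
  matter. The manifold is the whole type \<open>'a\<close>; its dimension is that of the model space \<open>'e\<close>.\<close>

type_synonym ('a, 'e) atlas = "('a set \<times> ('a \<Rightarrow> 'e)) set"

locale smooth_manifold =
  fixes A :: "('a::{t2_space, second_countable_topology}, 'e::euclidean_space) atlas"
  assumes chart: "(U, \<psi>) \<in> A \<Longrightarrow>
      open U \<and> open (\<psi> ` U) \<and> homeomorphism U (\<psi> ` U) \<psi> (inv_into U \<psi>)"
    and covering: "(\<Union>(U, \<psi>)\<in>A. U) = UNIV"
    and compatible: "(U, \<psi>) \<in> A \<Longrightarrow> (V, \<theta>) \<in> A \<Longrightarrow> smooth_on (\<psi> ` (U \<inter> V)) (\<theta> \<circ> inv_into U \<psi>)"

definition smooth_fun :: "('a, 'e::euclidean_space) atlas \<Rightarrow> ('a \<Rightarrow> real) \<Rightarrow> bool" where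
  "smooth_fun A f \<longleftrightarrow> (\<forall>(U, \<psi>)\<in>A. smooth_on (\<psi> ` U) (f \<circ> inv_into U \<psi>))"

text \<open>Tangent vectors at \<open>p\<close> are the directional derivatives at \<open>p\<close> in charts, acting on the smooth
  functions of the manifold. As functionals they are extended by 0 to non-smooth functions, so that
  equality of functionals is equality of tangent vectors.\<close>

type_synonym 'a tangent = "('a \<Rightarrow> real) \<Rightarrow> real"

definition tangent_space :: "('a, 'e::euclidean_space) atlas \<Rightarrow> 'a \<Rightarrow> 'a tangent set" where
  "tangent_space A p = {v. \<exists>(U, \<psi>)\<in>A. p \<in> U \<and> (\<exists>e. v =
     (\<lambda>f. if smooth_fun A f then frechet_derivative (f \<circ> inv_into U \<psi>) (at (\<psi> p)) e else 0))}"


section \<open>Vector fields and tensor fields\<close>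

text \<open>Tensor fields are given by their values at each point; only their values on tangent spaces
  are meaningful. Smoothness means that smooth vector fields are sent to smooth objects.\<close>

type_synonym 'a vector_field = "'a \<Rightarrow> 'a tangent"
type_synonym 'a one_form = "'a \<Rightarrow> 'a tangent \<Rightarrow> real"
type_synonym 'a endo_field = "'a \<Rightarrow> 'a tangent \<Rightarrow> 'a tangent"
type_synonym 'a bilinear_field = "'a \<Rightarrow> 'a tangent \<Rightarrow> 'a tangent \<Rightarrow> real"

definition smooth_vf :: "('a, 'e::euclidean_space) atlas \<Rightarrow> 'a vector_field \<Rightarrow> bool" where
  "smooth_vf A X \<longleftrightarrow> (\<forall>p. X p \<in> tangent_space A p) \<and>
     (\<forall>f. smooth_fun A f \<longrightarrow> smooth_fun A (\<lambda>p. X p f))"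

definition bracket :: "'a vector_field \<Rightarrow> 'a vector_field \<Rightarrow> 'a vector_field" where
  "bracket X Y = (\<lambda>p f. X p (\<lambda>q. Y q f) - Y p (\<lambda>q. X q f))"

definition app :: "('a \<Rightarrow> 'a tangent \<Rightarrow> 'b) \<Rightarrow> 'a vector_field \<Rightarrow> 'a \<Rightarrow> 'b" where
  "app T X = (\<lambda>p. T p (X p))"

definition smooth_one_form :: "('a, 'e::euclidean_space) atlas \<Rightarrow> 'a one_form \<Rightarrow> bool" where
  "smooth_one_form A \<alpha> \<longleftrightarrow>
     (\<forall>p. \<forall>v\<in>tangent_space A p. \<forall>w\<in>tangent_space A p. \<forall>a b.
        \<alpha> p (a *\<^sub>R v + b *\<^sub>R w) = a * \<alpha> p v + b * \<alpha> p w) \<and>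
     (\<forall>X. smooth_vf A X \<longrightarrow> smooth_fun A (app \<alpha> X))"

definition smooth_endo :: "('a, 'e::euclidean_space) atlas \<Rightarrow> 'a endo_field \<Rightarrow> bool" where
  "smooth_endo A T \<longleftrightarrow>
     (\<forall>p. \<forall>v\<in>tangent_space A p. T p v \<in> tangent_space A p) \<and>
     (\<forall>p. \<forall>v\<in>tangent_space A p. \<forall>w\<in>tangent_space A p. \<forall>a b.
        T p (a *\<^sub>R v + b *\<^sub>R w) = a *\<^sub>R T p v + b *\<^sub>R T p w) \<and>
     (\<forall>X. smooth_vf A X \<longrightarrow> smooth_vf A (app T X))"

definition riemannian_metric :: "('a, 'e::euclidean_space) atlas \<Rightarrow> 'a bilinear_field \<Rightarrow> bool" where
  "riemannian_metric A g \<longleftrightarrow>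
     (\<forall>p. \<forall>u\<in>tangent_space A p. \<forall>v\<in>tangent_space A p. \<forall>w\<in>tangent_space A p. \<forall>a b.
        g p (a *\<^sub>R u + b *\<^sub>R v) w = a * g p u w + b * g p v w) \<and>
     (\<forall>p. \<forall>v\<in>tangent_space A p. \<forall>w\<in>tangent_space A p. g p v w = g p w v) \<and>
     (\<forall>p. \<forall>v\<in>tangent_space A p. v \<noteq> 0 \<longrightarrow> g p v v > 0) \<and>
     (\<forall>X Y. smooth_vf A X \<longrightarrow> smooth_vf A Y \<longrightarrow> smooth_fun A (\<lambda>p. g p (X p) (Y p)))"

text \<open>The factor \<open>1/2\<close> is the convention \<open>2d\<eta>(X,Y) = X(\<eta>(Y)) - Y(\<eta>(X)) - \<eta>([X,Y])\<close>.\<close>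

definition ext_deriv :: "'a one_form \<Rightarrow> 'a vector_field \<Rightarrow> 'a vector_field \<Rightarrow> 'a \<Rightarrow> real" where
  "ext_deriv \<eta> X Y = (\<lambda>p. 1/2 * (X p (app \<eta> Y) - Y p (app \<eta> X) - app \<eta> (bracket X Y) p))"

definition nijenhuis :: "'a endo_field \<Rightarrow> 'a vector_field \<Rightarrow> 'a vector_field \<Rightarrow> 'a vector_field" where
  "nijenhuis T X Y = app T (app T (bracket X Y)) + bracket (app T X) (app T Y)
     - app T (bracket (app T X) Y) - app T (bracket X (app T Y))"

text \<open>The Lie derivative \<open>(L\<^sub>X T) Y = [X, T Y] - T [X, Y]\<close> is tensorial in \<open>Y\<close>; its value on a
  tangent vector \<open>v\<close> at \<open>p\<close> is obtained from any smooth extension \<open>Y\<close> of \<open>v\<close>.\<close>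

definition lie_deriv_endo ::
    "('a, 'e::euclidean_space) atlas \<Rightarrow> 'a vector_field \<Rightarrow> 'a endo_field \<Rightarrow> 'a endo_field" where
  "lie_deriv_endo A X T = (\<lambda>p v. THE w. \<forall>Y. smooth_vf A Y \<and> Y p = v \<longrightarrow>
     w = (bracket X (app T Y) - app T (bracket X Y)) p)"


section \<open>Levi-Civita connection and curvature\<close>

definition levi_civita :: "('a, 'e::euclidean_space) atlas \<Rightarrow> 'a bilinear_field \<Rightarrow>
    ('a vector_field \<Rightarrow> 'a vector_field \<Rightarrow> 'a vector_field) \<Rightarrow> bool" where
  "levi_civita A g D \<longleftrightarrow>
     (\<forall>X Y. smooth_vf A X \<longrightarrow> smooth_vf A Y \<longrightarrow> smooth_vf A (D X Y)) \<and>
     (\<forall>X Y Z. smooth_vf A X \<longrightarrow> smooth_vf A Y \<longrightarrow> smooth_vf A Z \<longrightarrow>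
        D (X + Y) Z = D X Z + D Y Z \<and> D X (Y + Z) = D X Y + D X Z) \<and>
     (\<forall>f X Y. smooth_fun A f \<longrightarrow> smooth_vf A X \<longrightarrow> smooth_vf A Y \<longrightarrow>
        D (\<lambda>p. f p *\<^sub>R X p) Y = (\<lambda>p. f p *\<^sub>R D X Y p) \<and>
        D X (\<lambda>p. f p *\<^sub>R Y p) = (\<lambda>p. X p f *\<^sub>R Y p + f p *\<^sub>R D X Y p)) \<and>
     (\<forall>X Y. smooth_vf A X \<longrightarrow> smooth_vf A Y \<longrightarrow> D X Y - D Y X = bracket X Y) \<and>
     (\<forall>X Y Z. smooth_vf A X \<longrightarrow> smooth_vf A Y \<longrightarrow> smooth_vf A Z \<longrightarrow>
        (\<forall>p. X p (\<lambda>q. g q (Y q) (Z q)) = g p (D X Y p) (Z p) + g p (Y p) (D X Z p)))"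

definition curvature :: "('a vector_field \<Rightarrow> 'a vector_field \<Rightarrow> 'a vector_field) \<Rightarrow>
    'a vector_field \<Rightarrow> 'a vector_field \<Rightarrow> 'a vector_field \<Rightarrow> 'a vector_field" where
  "curvature D X Y Z = D X (D Y Z) - D Y (D X Z) - D (bracket X Y) Z"


section \<open>Contact metric manifolds\<close>

locale contact_metric_manifold = smooth_manifold A
  for A :: "('a::{t2_space, second_countable_topology}, 'e::euclidean_space) atlas" +
  fixes n :: nat and \<phi> :: "'a endo_field" and \<xi> :: "'a vector_field"
    and \<eta> :: "'a one_form" and g :: "'a bilinear_field"
  assumes dimension: "DIM('e) = 2 * n + 1"
    and phi_smooth: "smooth_endo A \<phi>"
    and xi_smooth: "smooth_vf A \<xi>"
    and eta_smooth: "smooth_one_form A \<eta>"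
    and metric: "riemannian_metric A g"
    and phi_square: "v \<in> tangent_space A p \<Longrightarrow> \<phi> p (\<phi> p v) = - v + \<eta> p v *\<^sub>R \<xi> p"
    and eta_xi: "\<eta> p (\<xi> p) = 1"
    and compatible_metric: "v \<in> tangent_space A p \<Longrightarrow> w \<in> tangent_space A p \<Longrightarrow>
      g p (\<phi> p v) (\<phi> p w) = g p v w - \<eta> p v * \<eta> p w"
    and contact_metric: "smooth_vf A X \<Longrightarrow> smooth_vf A Y \<Longrightarrow>
      ext_deriv \<eta> X Y p = g p (X p) (\<phi> p (Y p))"

definition sasakian ::
    "('a, 'e::euclidean_space) atlas \<Rightarrow> 'a endo_field \<Rightarrow> 'a vector_field \<Rightarrow> 'a one_form \<Rightarrow> bool" where
  "sasakian A \<phi> \<xi> \<eta> \<longleftrightarrow> (\<forall>X Y. smooth_vf A X \<longrightarrow> smooth_vf A Y \<longrightarrow>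
     (\<forall>p. nijenhuis \<phi> X Y p + (2 * ext_deriv \<eta> X Y p) *\<^sub>R \<xi> p = 0))"

definition h_tensor ::
    "('a, 'e::euclidean_space) atlas \<Rightarrow> 'a endo_field \<Rightarrow> 'a vector_field \<Rightarrow> 'a endo_field" where
  "h_tensor A \<phi> \<xi> = (1/2) *\<^sub>R lie_deriv_endo A \<xi> \<phi>"

locale contact_metric_kappa_mu_space = contact_metric_manifold A n \<phi> \<xi> \<eta> g
  for A :: "('a::{t2_space, second_countable_topology}, 'e::euclidean_space) atlas"
    and n :: nat and \<phi> :: "'a endo_field" and \<xi> :: "'a vector_field"
    and \<eta> :: "'a one_form" and g :: "'a bilinear_field" +
  fixes \<kappa> \<mu> :: real
  assumes kappa_mu: "\<exists>D. levi_civita A g D \<and> (\<forall>X Y. smooth_vf A X \<longrightarrow> smooth_vf A Y \<longrightarrow>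
     (\<forall>p. curvature D X Y \<xi> p =
        \<kappa> *\<^sub>R (\<eta> p (Y p) *\<^sub>R X p - \<eta> p (X p) *\<^sub>R Y p) +
        \<mu> *\<^sub>R (\<eta> p (Y p) *\<^sub>R h_tensor A \<phi> \<xi> p (X p) - \<eta> p (X p) *\<^sub>R h_tensor A \<phi> \<xi> p (Y p))))"


section \<open>Legendre foliations and bi-paracontact structures\<close>

type_synonym 'a distribution = "'a \<Rightarrow> 'a tangent set"

definition comp_endo :: "'a endo_field \<Rightarrow> 'a endo_field \<Rightarrow> 'a endo_field" where
  "comp_endo S T = (\<lambda>p v. S p (T p v))"

definition eigendistribution ::
    "('a, 'e::euclidean_space) atlas \<Rightarrow> 'a endo_field \<Rightarrow> real \<Rightarrow> 'a distribution" where
  "eigendistribution A T c = (\<lambda>p. {v \<in> tangent_space A p. T p v = c *\<^sub>R v})"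

text \<open>Rank \<open>k\<close> subbundles of the tangent bundle, by smooth local frames. The frame fields are
  defined globally but only frame \<open>E\<close> on the neighbourhood \<open>W\<close>.\<close>

definition subbundle ::
    "('a::topological_space, 'e::euclidean_space) atlas \<Rightarrow> nat \<Rightarrow> 'a distribution \<Rightarrow> bool" where
  "subbundle A k E \<longleftrightarrow> (\<forall>p. \<exists>W (X :: nat \<Rightarrow> 'a vector_field). open W \<and> p \<in> W \<and>
     (\<forall>i<k. smooth_vf A (X i)) \<and>
     (\<forall>q\<in>W. inj_on (\<lambda>i. X i q) {..<k} \<and> independent ((\<lambda>i. X i q) ` {..<k}) \<and>
            span ((\<lambda>i. X i q) ` {..<k}) = E q))"

definition involutive :: "('a, 'e::euclidean_space) atlas \<Rightarrow> 'a distribution \<Rightarrow> bool" where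
  "involutive A E \<longleftrightarrow> (\<forall>X Y. smooth_vf A X \<longrightarrow> smooth_vf A Y \<longrightarrow>
     (\<forall>p. X p \<in> E p) \<longrightarrow> (\<forall>p. Y p \<in> E p) \<longrightarrow> (\<forall>p. bracket X Y p \<in> E p))"

definition legendre_foliation :: "('a::topological_space, 'e::euclidean_space) atlas \<Rightarrow> nat \<Rightarrow>
    'a one_form \<Rightarrow> 'a distribution \<Rightarrow> bool" where
  "legendre_foliation A n \<eta> E \<longleftrightarrow>
     subbundle A n E \<and> (\<forall>p. \<forall>v\<in>E p. \<eta> p v = 0) \<and> involutive A E"

definition almost_bi_paracontact :: "('a, 'e::euclidean_space) atlas \<Rightarrow> 'a vector_field \<Rightarrow>
    'a one_form \<Rightarrow> 'a endo_field \<Rightarrow> 'a endo_field \<Rightarrow> 'a endo_field \<Rightarrow> bool" where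
  "almost_bi_paracontact A \<xi> \<eta> \<phi>1 \<phi>2 \<phi>3 \<longleftrightarrow>
     smooth_endo A \<phi>1 \<and> smooth_endo A \<phi>2 \<and> smooth_endo A \<phi>3 \<and>
     (\<forall>p. \<forall>v\<in>tangent_space A p.
        \<phi>1 p (\<phi>2 p v) = - \<phi>2 p (\<phi>1 p v) \<and>
        \<phi>1 p (\<phi>1 p v) = v - \<eta> p v *\<^sub>R \<xi> p \<and>
        \<phi>2 p (\<phi>2 p v) = v - \<eta> p v *\<^sub>R \<xi> p \<and>
        \<phi>3 p v = \<phi>1 p (\<phi>2 p v) \<and>
        \<phi>3 p (\<phi>3 p v) = - v + \<eta> p v *\<^sub>R \<xi> p)"

definition integrable_bi_paracontact ::
    "('a::topological_space, 'e::euclidean_space) atlas \<Rightarrow> nat \<Rightarrow> 'a vector_field \<Rightarrow>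
     'a one_form \<Rightarrow> 'a endo_field \<Rightarrow> 'a endo_field \<Rightarrow> 'a endo_field \<Rightarrow> bool" where
  "integrable_bi_paracontact A n \<xi> \<eta> \<phi>1 \<phi>2 \<phi>3 \<longleftrightarrow>
     almost_bi_paracontact A \<xi> \<eta> \<phi>1 \<phi>2 \<phi>3 \<and>
     (\<forall>T\<in>{\<phi>1, \<phi>2}. \<forall>c\<in>{1, -1}. legendre_foliation A n \<eta> (eigendistribution A T c))"

definition standard_bi_paracontact ::
    "('a::topological_space, 'e::euclidean_space) atlas \<Rightarrow> nat \<Rightarrow> 'a endo_field \<Rightarrow>
     'a vector_field \<Rightarrow> 'a one_form \<Rightarrow> real \<Rightarrow>
     'a endo_field \<Rightarrow> 'a endo_field \<Rightarrow> 'a endo_field \<Rightarrow> bool" where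
  "standard_bi_paracontact A n \<phi> \<xi> \<eta> \<kappa> \<phi>1 \<phi>2 \<phi>3 \<longleftrightarrow>
     (let h = h_tensor A \<phi> \<xi>; \<phi>h = comp_endo \<phi> h; l = sqrt (1 - \<kappa>) in
       integrable_bi_paracontact A n \<xi> \<eta> \<phi>1 \<phi>2 \<phi>3 \<and>
       (\<forall>p. (\<forall>v\<in>eigendistribution A \<phi>h l p. \<phi>1 p v = v) \<and>
            (\<forall>v\<in>eigendistribution A \<phi>h (- l) p. \<phi>1 p v = - v) \<and>
            \<phi>1 p (\<xi> p) = 0 \<and>
            (\<forall>v\<in>eigendistribution A h l p. \<phi>2 p v = v) \<and>
            (\<forall>v\<in>eigendistribution A h (- l) p. \<phi>2 p v = - v) \<and>
            \<phi>2 p (\<xi> p) = 0 \<and>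
            (\<forall>v\<in>tangent_space A p. \<phi>3 p v = \<phi>1 p (\<phi>2 p v))))"

definition endo_eq ::
    "('a, 'e::euclidean_space) atlas \<Rightarrow> 'a endo_field \<Rightarrow> 'a endo_field \<Rightarrow> bool" where
  "endo_eq A S T \<longleftrightarrow> (\<forall>p. \<forall>v\<in>tangent_space A p. S p v = T p v)"

end

theory Submission
  imports Defs
begin

text \<open>Write \<open>h\<close> for half the Lie derivative of \<open>\<phi>\<close> along \<open>\<xi>\<close> and \<open>\<lambda> = sqrt (1 - \<kappa>)\<close>. As soon as
  \<open>h \<phi> = - \<phi> h\<close>, \<open>h\<^sup>2 = \<lambda>\<^sup>2 (I - \<eta> \<otimes> \<xi>)\<close> and \<open>\<lambda> > 0\<close> are known, the tensors \<open>\<phi> h / \<lambda>\<close>, \<open>h / \<lambda>\<close> and \<open>\<phi>\<close>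
  satisfy the relations of an almost bi-paracontact structure. Moreover every tangent space is spanned
  by \<open>\<xi>\<close> and the two eigenspaces of \<open>h\<close>, and likewise by \<open>\<xi>\<close> and those of \<open>\<phi> h\<close>, so that prescribing a
  linear map there leaves no freedom: this is the uniqueness part (\<open>endo_unique\<close>). The substance of the
  theorem is therefore the formula for \<open>h\<^sup>2\<close>, the bound \<open>\<kappa> < 1\<close>, and the fact that the
  eigendistributions are Legendre foliations.

  Everything rests on the formula \<open>D\<^sub>X \<xi> = - \<phi> X - \<phi> h X\<close> (\<open>D_xi\<close>). The skew part of \<open>X \<mapsto> D\<^sub>X \<xi>\<close> is given
  by \<open>d\<eta> = g(\<cdot>, \<phi> \<cdot>)\<close>, and its symmetric part by the invariance of \<open>d\<eta>\<close> under the flow of \<open>\<xi>\<close>. It turns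
  the curvature condition into equations for the first derivatives of \<open>\<phi>\<close> and \<open>h\<close>:

  \<^item> For \<open>R(X, \<xi>)\<xi>\<close>, the part that commutes with \<open>\<phi>\<close> says \<open>h\<^sup>2 = (1 - \<kappa>) (I - \<eta> \<otimes> \<xi>)\<close> (\<open>h_h\<close>). Since \<open>h\<close> is
    symmetric, \<open>\<kappa> \<ge> 1\<close> forces \<open>h = 0\<close>. Then \<open>R(X, Y)\<xi> = \<eta>(Y) X - \<eta>(X) Y\<close>, and this determines the
    alternation of \<open>D \<phi>\<close>, hence \<open>D \<phi>\<close> by \<open>d\<^sup>2\<eta> = 0\<close>, and the structure is Sasakian (\<open>kappa_less_1\<close>).

  \<^item> For \<open>X\<close> and \<open>Y\<close> in \<open>ker \<eta>\<close> one has \<open>R(X, Y)\<xi> = 0\<close>. Evaluated on eigenfields of \<open>\<phi> h\<close> this expresses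
    \<open>g((D\<^sub>Z \<phi>) X, Y)\<close> by \<open>g(D\<^sub>X Y, Z)\<close> and \<open>g(D\<^sub>Y X, Z)\<close> with coefficients that vanish if the three
    eigenvalues agree. Together with the symmetries of \<open>D \<phi>\<close> this gives \<open>g((D\<^sub>X \<phi>) Y, Z) = 0\<close> on \<open>ker \<eta>\<close>
    (\<open>cov_phi_horizontal\<close>). With this, \<open>R(X, Y)\<xi> = 0\<close> for two fields \<open>X\<close>, \<open>Y\<close> in one eigendistribution
    of \<open>h\<close> or \<open>\<phi> h\<close> says that \<open>[X, Y]\<close> lies in it, too (\<open>involutive_h\<close>, \<open>involutive_phi_h\<close>).

  The rank of the eigendistributions is \<open>n\<close> because \<open>\<phi>\<close> interchanges the two eigenspaces of \<open>h\<close> and those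
  of \<open>\<phi> h\<close>, which together span a complement of \<open>\<xi>\<close> (\<open>E_basis\<close>).

  Tangent vectors are functionals on globally defined smooth functions. Bump functions show that they
  separate the directions in a chart, so that tangent spaces have the dimension of the model space
  (\<open>tangent_space_basis\<close>), and that each of them is a value of a global smooth vector field
  (\<open>tangent_extension\<close>). The geometric identities are therefore proved for global fields and read
  pointwise afterwards. A bracket of smooth fields is smooth because it is the
  difference \<open>D\<^sub>X Y - D\<^sub>Y X\<close> for the Levi-Civita connection.\<close>

section \<open>Smooth maps on open sets of normed spaces\<close>

lemma frechet_derivative_at_cong:
  assumes "open S" "x \<in> S" "\<And>y. y \<in> S \<Longrightarrow> f y = g y"
  shows "frechet_derivative f (at x) = frechet_derivative g (at x)"
proof -
  have "(f has_derivative D) (at x) \<longleftrightarrow> (g has_derivative D) (at x)" for D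
    using assms has_derivative_transform_within_open[of f D x UNIV S g]
      has_derivative_transform_within_open[of g D x UNIV S f] by auto
  then show ?thesis by (simp add: frechet_derivative_def)
qed

lemma times_differentiable_on_cong:
  assumes "open S" "\<And>x. x \<in> S \<Longrightarrow> f x = g x" "times_differentiable_on k S f"
  shows "times_differentiable_on k S g"
  using assms(2,3)
proof (induction k arbitrary: f g)
  case 0
  then show ?case using continuous_on_cong[of S S f g] by auto
next
  case (Suc k)
  have "g differentiable_on S"
    unfolding differentiable_on_def
  proof
    fix x assume x: "x \<in> S"
    then have "f differentiable at x within S" using Suc.prems by (simp add: differentiable_on_def)
    then show "g differentiable at x within S"
      by (rule differentiable_transform_within[OF _ zero_less_one x]) (use Suc.prems in auto)
  qed
  moreover have "times_differentiable_on k S (\<lambda>x. frechet_derivative g (at x) v)" for v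
    by (rule Suc.IH[of "\<lambda>x. frechet_derivative f (at x) v"])
       (use Suc.prems assms(1) frechet_derivative_at_cong[of S _ f g] in auto)
  ultimately show ?case by simp
qed

lemma times_differentiable_on_subset:
  assumes "times_differentiable_on k S f" "T \<subseteq> S"
  shows "times_differentiable_on k T f"
  using assms
proof (induction k arbitrary: f)
  case 0
  then show ?case using continuous_on_subset by auto
next
  case (Suc k)
  then show ?case using differentiable_on_subset by auto
qed

text \<open>Being of class \<open>C\<^sup>k\<close> is a local property; this is what allows functions on the manifold to be pieced
  together from different charts.\<close>

lemma times_differentiable_on_local:
  assumes "\<And>x. x \<in> S \<Longrightarrow> \<exists>T. open T \<and> x \<in> T \<and> times_differentiable_on k T f"
  shows "times_differentiable_on k S f"
  using assms
proof (induction k arbitrary: f)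
  case 0
  show ?case
    unfolding times_differentiable_on.simps continuous_on_eq_continuous_within
  proof
    fix x assume "x \<in> S"
    then obtain T where "open T" "x \<in> T" "continuous_on T f" using 0 by auto
    then show "continuous (at x within S) f"
      using continuous_on_eq_continuous_at continuous_at_imp_continuous_at_within by blast
  qed
next
  case (Suc k)
  have "f differentiable_on S"
    unfolding differentiable_on_def
  proof
    fix x assume "x \<in> S"
    then obtain T where "open T" "x \<in> T" "f differentiable_on T" using Suc.prems by force
    then show "f differentiable (at x within S)"
      using differentiable_on_eq_differentiable_at differentiable_at_withinI by blast
  qed
  moreover have "times_differentiable_on k S (\<lambda>x. frechet_derivative f (at x) v)" for v
    by (rule Suc.IH) (use Suc.prems in fastforce)
  ultimately show ?case by simp
qed

lemma times_differentiable_on_SucD: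
  assumes "times_differentiable_on (Suc k) S f"
  shows "times_differentiable_on k S f"
  using assms
proof (induction k arbitrary: f)
  case 0
  then show ?case using differentiable_imp_continuous_on by auto
next
  case (Suc k)
  then show ?case by (metis times_differentiable_on.simps(2))
qed

lemma times_differentiable_on_const: "times_differentiable_on k S (\<lambda>x. c)"
  by (induction k arbitrary: c) (auto simp: frechet_derivative_const)

lemma times_differentiable_on_bounded_linear:
  assumes "bounded_linear L" "open S" "times_differentiable_on k S f"
  shows "times_differentiable_on k S (\<lambda>x. L (f x))"
  using assms(3)
proof (induction k arbitrary: f)
  case 0
  then show ?case using assms(1) bounded_linear.continuous_on by auto
next
  case (Suc k)
  have d: "((\<lambda>x. L (f x)) has_derivative (\<lambda>v. L (frechet_derivative f (at x) v))) (at x)"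
    if "x \<in> S" for x
  proof -
    have "(f has_derivative frechet_derivative f (at x)) (at x)"
      using Suc.prems that assms(2) differentiable_on_eq_differentiable_at frechet_derivative_works
      by (metis times_differentiable_on.simps(2))
    then show ?thesis using assms(1) bounded_linear.has_derivative by blast
  qed
  have "times_differentiable_on k S (\<lambda>x. frechet_derivative (\<lambda>x. L (f x)) (at x) v)" for v
    by (rule times_differentiable_on_cong[OF assms(2), of "\<lambda>x. L (frechet_derivative f (at x) v)"])
       (use Suc frechet_derivative_at[OF d] in \<open>auto simp: fun_eq_iff\<close>)
  moreover have "(\<lambda>x. L (f x)) differentiable_on S"
    unfolding differentiable_on_eq_differentiable_at[OF assms(2)] differentiable_def
    using d by (intro ballI exI)
  ultimately show ?case by simp
qed

lemma times_differentiable_on_add: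
  assumes "open S" "times_differentiable_on k S f" "times_differentiable_on k S g"
  shows "times_differentiable_on k S (\<lambda>x. f x + g x)"
  using assms(2,3)
proof (induction k arbitrary: f g)
  case 0
  then show ?case by (auto intro: continuous_intros)
next
  case (Suc k)
  have df: "f differentiable at x" and dg: "g differentiable at x" if "x \<in> S" for x
    using Suc.prems that assms(1) by (auto simp: differentiable_on_eq_differentiable_at)
  have "times_differentiable_on k S (\<lambda>x. frechet_derivative (\<lambda>x. f x + g x) (at x) v)" for v
    by (rule times_differentiable_on_cong[OF assms(1),
          of "\<lambda>x. frechet_derivative f (at x) v + frechet_derivative g (at x) v"])
       (use Suc frechet_derivative_at[OF has_derivative_add[OF df[unfolded frechet_derivative_works]
          dg[unfolded frechet_derivative_works]]] in \<open>auto simp: fun_eq_iff\<close>)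
  then show ?case using Suc.prems by (auto intro: differentiable_on_add)
qed

lemma times_differentiable_on_mult:
  fixes f g :: "'e::real_normed_vector \<Rightarrow> real"
  assumes "open S" "times_differentiable_on k S f" "times_differentiable_on k S g"
  shows "times_differentiable_on k S (\<lambda>x. f x * g x)"
  using assms(2,3)
proof (induction k arbitrary: f g)
  case 0
  then show ?case by (auto intro: continuous_intros)
next
  case (Suc k)
  have df: "f differentiable at x" and dg: "g differentiable at x" if "x \<in> S" for x
    using Suc.prems that assms(1) by (auto simp: differentiable_on_eq_differentiable_at)
  have "times_differentiable_on k S (\<lambda>x. frechet_derivative (\<lambda>x. f x * g x) (at x) v)" for v
    by (rule times_differentiable_on_cong[OF assms(1),
          of "\<lambda>x. f x * frechet_derivative g (at x) v + frechet_derivative f (at x) v * g x"])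
       (use Suc frechet_derivative_at[OF has_derivative_mult[OF df[unfolded frechet_derivative_works]
          dg[unfolded frechet_derivative_works]]] times_differentiable_on_SucD[OF Suc.prems(1)]
          times_differentiable_on_SucD[OF Suc.prems(2)] assms(1)
        in \<open>auto simp: fun_eq_iff intro!: times_differentiable_on_add\<close>)
  then show ?case using Suc.prems by (auto intro: differentiable_on_mult)
qed

lemma times_differentiable_on_sum:
  assumes "open S" "\<And>i. i \<in> I \<Longrightarrow> times_differentiable_on k S (f i)"
  shows "times_differentiable_on k S (\<lambda>x. \<Sum>i\<in>I. f i x)"
  using assms(2)
  by (induction I rule: infinite_finite_induct)
     (auto simp: times_differentiable_on_const intro: times_differentiable_on_add[OF assms(1)])

text \<open>By the chain rule a directional derivative of \<open>f \<circ> g\<close> is a sum, over a basis, of products of components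
  of the derivative of \<open>g\<close> and partial derivatives of \<open>f\<close> composed with \<open>g\<close>. The induction hypothesis for
  \<open>k\<close>, applied to the partial derivatives in place of \<open>f\<close>, covers the second factor. Finite dimension of
  the intermediate space is what makes the sum finite.\<close>

lemma times_differentiable_on_compose:
  fixes f :: "'d::euclidean_space \<Rightarrow> real" and g :: "'c::real_normed_vector \<Rightarrow> 'd"
  assumes "open S" "open T" "g ` S \<subseteq> T"
    and "times_differentiable_on k S g" "times_differentiable_on k T f"
  shows "times_differentiable_on k S (\<lambda>x. f (g x))"
  using assms(4,5)
proof (induction k arbitrary: f)
  case 0
  then show ?case using assms(3) continuous_on_compose2 by auto
next
  case (Suc k)
  have d: "((\<lambda>x. f (g x)) has_derivative
      (\<lambda>v. \<Sum>b\<in>Basis. (frechet_derivative g (at x) v \<bullet> b) * frechet_derivative f (at (g x)) b)) (at x)"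
    if "x \<in> S" for x
  proof -
    let ?F = "frechet_derivative f (at (g x))"
    have g: "(g has_derivative frechet_derivative g (at x)) (at x)"
      using Suc.prems that assms(1) differentiable_on_eq_differentiable_at frechet_derivative_works
      by (metis times_differentiable_on.simps(2))
    have f: "(f has_derivative ?F) (at (g x))"
      using Suc.prems that assms(2,3) differentiable_on_eq_differentiable_at frechet_derivative_works
      by (metis times_differentiable_on.simps(2) image_subset_iff)
    have "?F w = (\<Sum>b\<in>Basis. (w \<bullet> b) * ?F b)" for w
      using linear_sum[OF has_derivative_linear[OF f], of "\<lambda>b. (w \<bullet> b) *\<^sub>R b" Basis]
      by (simp add: euclidean_representation linear_cmul[OF has_derivative_linear[OF f]])
    then have "(\<lambda>v. ?F (frechet_derivative g (at x) v)) =
       (\<lambda>v. \<Sum>b\<in>Basis. (frechet_derivative g (at x) v \<bullet> b) * ?F b)" by (metis (no_types))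
    then show ?thesis using has_derivative_compose[OF g f] by simp
  qed
  have "times_differentiable_on k S (\<lambda>x. frechet_derivative (\<lambda>x. f (g x)) (at x) v)" for v
  proof (rule times_differentiable_on_cong[OF assms(1)])
    show "(\<Sum>b\<in>Basis. (frechet_derivative g (at x) v \<bullet> b) * frechet_derivative f (at (g x)) b)
      = frechet_derivative (\<lambda>x. f (g x)) (at x) v" if "x \<in> S" for x
      using frechet_derivative_at[OF d[OF that]] by (simp add: fun_eq_iff)
    show "times_differentiable_on k S (\<lambda>x. \<Sum>b\<in>Basis. (frechet_derivative g (at x) v \<bullet> b) *
        frechet_derivative f (at (g x)) b)"
    proof (intro times_differentiable_on_sum times_differentiable_on_mult assms(1))
      fix b :: 'd
      show "times_differentiable_on k S (\<lambda>x. frechet_derivative g (at x) v \<bullet> b)"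
        using Suc.prems assms(1)
        by (intro times_differentiable_on_bounded_linear[of "\<lambda>y. y \<bullet> b"])
           (auto intro: bounded_linear_inner_left)
      show "times_differentiable_on k S (\<lambda>x. frechet_derivative f (at (g x)) b)"
        using Suc.prems times_differentiable_on_SucD[OF Suc.prems(1)] by (intro Suc.IH) auto
    qed
  qed
  moreover have "(\<lambda>x. f (g x)) differentiable_on S"
    unfolding differentiable_on_eq_differentiable_at[OF assms(1)] differentiable_def
    using d by (intro ballI exI)
  ultimately show ?case by simp
qed

lemma times_differentiable_on_id: "times_differentiable_on k S (\<lambda>x. x)"
proof (cases k)
  case (Suc j)
  have "frechet_derivative (\<lambda>x. x) (at x) v = v" for x v :: 'a
    using frechet_derivative_at[OF has_derivative_ident[of "at x"]] by metis
  then show ?thesis using Suc by (simp add: times_differentiable_on_const)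
qed auto

lemma smooth_onI: "(\<And>k. times_differentiable_on k S f) \<Longrightarrow> smooth_on S f"
  by (simp add: smooth_on_def)

lemma smooth_on_differentiable_at: "smooth_on S f \<Longrightarrow> open S \<Longrightarrow> x \<in> S \<Longrightarrow> f differentiable at x"
  unfolding smooth_on_def
  by (metis times_differentiable_on.simps(2) differentiable_on_eq_differentiable_at)

lemma smooth_on_imp_continuous_on: "smooth_on S f \<Longrightarrow> continuous_on S f"
  unfolding smooth_on_def by (metis times_differentiable_on.simps(1))

lemma smooth_on_frechet_derivative:
  "smooth_on S f \<Longrightarrow> smooth_on S (\<lambda>x. frechet_derivative f (at x) v)"
  unfolding smooth_on_def by (metis times_differentiable_on.simps(2))

lemma smooth_on_cong: "smooth_on S f \<Longrightarrow> open S \<Longrightarrow> (\<And>x. x \<in> S \<Longrightarrow> f x = g x) \<Longrightarrow> smooth_on S g"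
  unfolding smooth_on_def using times_differentiable_on_cong by blast

lemma smooth_on_subset: "smooth_on S f \<Longrightarrow> T \<subseteq> S \<Longrightarrow> smooth_on T f"
  unfolding smooth_on_def using times_differentiable_on_subset by blast

lemma smooth_on_local:
  "(\<And>x. x \<in> S \<Longrightarrow> \<exists>T. open T \<and> x \<in> T \<and> smooth_on T f) \<Longrightarrow> smooth_on S f"
  unfolding smooth_on_def by (intro allI times_differentiable_on_local) fast

lemma smooth_on_const: "smooth_on S (\<lambda>x. c)"
  by (simp add: smooth_on_def times_differentiable_on_const)

lemma smooth_on_add: "open S \<Longrightarrow> smooth_on S f \<Longrightarrow> smooth_on S g \<Longrightarrow> smooth_on S (\<lambda>x. f x + g x)"
  by (simp add: smooth_on_def times_differentiable_on_add)

lemma smooth_on_mult: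
  fixes f g :: "'e::real_normed_vector \<Rightarrow> real"
  shows "open S \<Longrightarrow> smooth_on S f \<Longrightarrow> smooth_on S g \<Longrightarrow> smooth_on S (\<lambda>x. f x * g x)"
  by (simp add: smooth_on_def times_differentiable_on_mult)

lemma smooth_on_compose:
  fixes f :: "'d::euclidean_space \<Rightarrow> real" and g :: "'c::real_normed_vector \<Rightarrow> 'd"
  assumes "open S" "open T" "g ` S \<subseteq> T" "smooth_on S g" "smooth_on T f"
  shows "smooth_on S (\<lambda>x. f (g x))"
  using assms times_differentiable_on_compose[of S T g _ f] by (simp add: smooth_on_def)

lemma smooth_on_inner_diff:
  fixes w x0 :: "'e::euclidean_space"
  assumes "open S"
  shows "smooth_on S (\<lambda>x. (x - x0) \<bullet> w)"
proof (rule smooth_onI)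
  fix k
  have "times_differentiable_on k S (\<lambda>x. x \<bullet> w + - (x0 \<bullet> w))"
    using times_differentiable_on_bounded_linear[OF bounded_linear_inner_left assms
        times_differentiable_on_id] assms
    by (intro times_differentiable_on_add times_differentiable_on_const) auto
  then show "times_differentiable_on k S (\<lambda>x. (x - x0) \<bullet> w)" by (simp add: inner_diff_left)
qed

section \<open>Bump functions\<close>

text \<open>The derivative of \<open>exp (- 1 / t)\<close> contains a factor \<open>1 / t\<^sup>2\<close>; the powers of \<open>1 / t\<close> are included here
  because the resulting family is closed under differentiation.\<close>

definition flat_exp :: "nat \<Rightarrow> real \<Rightarrow> real" where
  "flat_exp k t = (if t > 0 then exp (- inverse t) * inverse t ^ k else 0)"

lemma flat_exp_over_tendsto_0: "((\<lambda>t. flat_exp k t / t) \<longlongrightarrow> 0) (at 0)"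
proof -
  have "((\<lambda>t. inverse t ^ Suc k / exp (inverse t :: real)) \<longlongrightarrow> 0) (at_right 0)"
    using filterlim_compose[OF tendsto_power_div_exp_0[of "Suc k"] filterlim_inverse_at_top_right] .
  moreover have "eventually (\<lambda>t. inverse t ^ Suc k / exp (inverse t) = flat_exp k t / t) (at_right (0::real))"
    by (rule eventually_at_rightI[of 0 1]) (auto simp: flat_exp_def exp_minus field_simps)
  ultimately have r: "((\<lambda>t. flat_exp k t / t) \<longlongrightarrow> 0) (at_right 0)"
    using tendsto_cong by fastforce
  have "eventually (\<lambda>t. 0 = flat_exp k t / t) (at_left (0::real))"
    by (rule eventually_at_leftI[of "-1" 0]) (auto simp: flat_exp_def)
  then have l: "((\<lambda>t. flat_exp k t / t) \<longlongrightarrow> 0) (at_left 0)"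
    using tendsto_cong[of "\<lambda>t. 0" "\<lambda>t. flat_exp k t / t" "at_left 0" 0] by simp
  show ?thesis using l r filterlim_split_at by blast
qed

lemma flat_exp_DERIV:
  "(flat_exp k has_field_derivative (flat_exp (k+2) t - real k * flat_exp (k+1) t)) (at t)"
proof (cases t "0::real" rule: linorder_cases)
  case less
  have "((\<lambda>t. 0) has_field_derivative 0) (at t)" by simp
  then have "(flat_exp k has_field_derivative 0) (at t)"
    by (rule has_field_derivative_transform_within_open[of _ _ _ "{..<0}"])
       (use less in \<open>auto simp: flat_exp_def\<close>)
  then show ?thesis using less by (simp add: flat_exp_def)
next
  case equal
  have "(flat_exp k has_field_derivative 0) (at 0)"
    using flat_exp_over_tendsto_0[of k] by (simp add: has_field_derivative_iff flat_exp_def)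
  then show ?thesis using equal by (simp add: flat_exp_def)
next
  case greater
  have i: "(inverse has_field_derivative - (inverse t * inverse t)) (at t)"
    using greater by (auto intro!: derivative_eq_intros simp: power2_eq_square)
  have e: "((\<lambda>t. exp (- inverse t)) has_field_derivative exp (- inverse t) * (inverse t * inverse t)) (at t)"
    using DERIV_fun_exp[OF DERIV_minus[OF i]] by simp
  have "((\<lambda>t. exp (- inverse t) * inverse t ^ k) has_field_derivative
      (exp (- inverse t) * inverse t ^ (k+2) - real k * (exp (- inverse t) * inverse t ^ (k+1)))) (at t)"
    by (rule DERIV_cong[OF DERIV_mult[OF e DERIV_power[OF i, of k]]])
       (cases k, simp_all add: algebra_simps)
  then have "((\<lambda>t. exp (- inverse t) * inverse t ^ k) has_field_derivative
      (flat_exp (k+2) t - real k * flat_exp (k+1) t)) (at t)"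
    using greater by (simp add: flat_exp_def)
  then show ?thesis
    by (rule has_field_derivative_transform_within_open[of _ _ _ "{0<..}"])
       (use greater in \<open>auto simp: flat_exp_def\<close>)
qed

lemma smooth_on_flat_exp: "smooth_on UNIV (flat_exp k)"
proof (rule smooth_onI)
  fix m
  show "times_differentiable_on m UNIV (flat_exp k)"
  proof (induction m arbitrary: k)
    case 0
    show ?case using flat_exp_DERIV[THEN DERIV_isCont] by (simp add: continuous_at_imp_continuous_on)
  next
    case (Suc m)
    have d: "frechet_derivative (flat_exp k) (at t) v =
       v * (flat_exp (k+2) t + - real k * flat_exp (k+1) t)" for t v
      using frechet_derivative_at[OF flat_exp_DERIV[of k t, unfolded has_field_derivative_def]]
      by (simp add: fun_eq_iff mult.commute)
    have "flat_exp k differentiable_on UNIV"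
      using flat_exp_DERIV[of k] unfolding differentiable_on_def has_field_derivative_def differentiable_def
      by blast
    then show ?case
      unfolding times_differentiable_on.simps d
      by (intro conjI allI times_differentiable_on_mult times_differentiable_on_add
            times_differentiable_on_const Suc.IH) auto
  qed
qed

text \<open>The function \<open>x \<mapsto> flat_exp 0 (r\<^sup>2 - \<bar>x - x0\<bar>\<^sup>2)\<close>, normalised at \<open>x0\<close>. For the extension
  of a vector or a linear form at one point, the value 1 at that point suffices.\<close>

lemma exists_smooth_bump:
  fixes x0 :: "'e::euclidean_space"
  assumes "r > 0"
  obtains b :: "'e \<Rightarrow> real" where "smooth_on UNIV b" "b x0 = 1" "\<And>x. x \<notin> cball x0 r \<Longrightarrow> b x = 0"
proof
  \<comment> \<open>The squared norm is written as a sum of products of affine functions, whose smoothness is known.\<close>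
  define b where "b x = flat_exp 0 (r\<^sup>2 + (- 1) * (\<Sum>i\<in>Basis. ((x - x0) \<bullet> i) * ((x - x0) \<bullet> i))) * exp (inverse (r\<^sup>2))"
    for x
  have n: "(\<Sum>i\<in>Basis. ((x - x0) \<bullet> i) * ((x - x0) \<bullet> i)) = (dist x0 x)\<^sup>2" for x
  proof -
    have "(dist x0 x)\<^sup>2 = (x - x0) \<bullet> (x - x0)"
      by (metis dist_norm dist_commute power2_norm_eq_inner)
    then show ?thesis using euclidean_inner[of "x - x0" "x - x0"] by simp
  qed
  have "smooth_on UNIV (\<lambda>x. r\<^sup>2 + (- 1) * (\<Sum>i\<in>Basis. ((x - x0) \<bullet> i) * ((x - x0) \<bullet> i)))"
    using smooth_on_inner_diff[of UNIV x0] unfolding smooth_on_def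
    by (intro allI times_differentiable_on_add times_differentiable_on_mult
        times_differentiable_on_sum times_differentiable_on_const) auto
  then show "smooth_on UNIV b"
    unfolding b_def
    by (intro smooth_on_mult[OF open_UNIV _ smooth_on_const]
          smooth_on_compose[OF open_UNIV open_UNIV subset_UNIV _ smooth_on_flat_exp])
  show "b x0 = 1" using assms by (simp add: b_def n flat_exp_def exp_minus)
  show "b x = 0" if "x \<notin> cball x0 r" for x
  proof -
    have "r\<^sup>2 < (dist x0 x)\<^sup>2" using that assms by (simp add: power_strict_mono)
    then show ?thesis unfolding b_def n by (simp add: flat_exp_def)
  qed
qed

section \<open>Smooth functions and tangent spaces\<close>

context smooth_manifold
begin

lemma chartD:
  assumes "(U, \<psi>) \<in> A"
  shows "open U" "open (\<psi> ` U)" "inj_on \<psi> U" "continuous_on U \<psi>"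
    "continuous_on (\<psi> ` U) (inv_into U \<psi>)"
proof -
  have h: "homeomorphism U (\<psi> ` U) \<psi> (inv_into U \<psi>)" using chart[OF assms] by blast
  show "open U" "open (\<psi> ` U)" using chart[OF assms] by auto
  show "inj_on \<psi> U" using h unfolding homeomorphism_def by (metis inj_on_inverseI)
  show "continuous_on U \<psi>" "continuous_on (\<psi> ` U) (inv_into U \<psi>)"
    using h unfolding homeomorphism_def by auto
qed

lemma inv_chart: "(U, \<psi>) \<in> A \<Longrightarrow> q \<in> U \<Longrightarrow> inv_into U \<psi> (\<psi> q) = q"
  using chartD(3) by (simp add: inv_into_f_f)

lemma obtain_chart:
  obtains U \<psi> where "(U, \<psi>) \<in> A" "p \<in> U"
proof -
  have "p \<in> (\<Union>(U, \<psi>)\<in>A. U)" by (simp add: covering)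
  then show ?thesis using that by auto
qed

lemma open_chart_image:
  assumes "(U, \<psi>) \<in> A" "open W"
  shows "open (\<psi> ` (U \<inter> W))"
proof -
  have "\<psi> ` (U \<inter> W) = \<psi> ` U \<inter> inv_into U \<psi> -` W"
    using inv_chart[OF assms(1)] by auto
  then show ?thesis
    using continuous_open_preimage[OF chartD(5,2)[OF assms(1)] assms(2)] by simp
qed

lemma smooth_funD: "smooth_fun A f \<Longrightarrow> (U, \<psi>) \<in> A \<Longrightarrow> smooth_on (\<psi> ` U) (f \<circ> inv_into U \<psi>)"
  unfolding smooth_fun_def by blast

lemma smooth_fun_const: "smooth_fun A (\<lambda>p. c)"
  unfolding smooth_fun_def by (auto simp: o_def smooth_on_const)

lemma smooth_fun_add: "smooth_fun A f \<Longrightarrow> smooth_fun A h \<Longrightarrow> smooth_fun A (\<lambda>p. f p + h p)"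
  unfolding smooth_fun_def o_def using chartD(2) smooth_on_add by blast

lemma smooth_fun_mult: "smooth_fun A f \<Longrightarrow> smooth_fun A h \<Longrightarrow> smooth_fun A (\<lambda>p. f p * h p)"
  unfolding smooth_fun_def o_def using chartD(2) smooth_on_mult by blast

lemma smooth_fun_uminus: "smooth_fun A f \<Longrightarrow> smooth_fun A (\<lambda>p. - f p)"
  using smooth_fun_mult[OF smooth_fun_const[of "-1"]] by simp

lemma smooth_fun_diff: "smooth_fun A f \<Longrightarrow> smooth_fun A h \<Longrightarrow> smooth_fun A (\<lambda>p. f p - h p)"
  using smooth_fun_add[OF _ smooth_fun_uminus] by fastforce

lemma smooth_fun_differentiable:
  "smooth_fun A f \<Longrightarrow> (U, \<psi>) \<in> A \<Longrightarrow> p \<in> U \<Longrightarrow> (f \<circ> inv_into U \<psi>) differentiable at (\<psi> p)"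
  using smooth_funD smooth_on_differentiable_at chartD(2) by blast

lemma smooth_fun_has_derivative:
  "smooth_fun A f \<Longrightarrow> (U, \<psi>) \<in> A \<Longrightarrow> p \<in> U \<Longrightarrow>
     (f \<circ> inv_into U \<psi> has_derivative frechet_derivative (f \<circ> inv_into U \<psi>) (at (\<psi> p))) (at (\<psi> p))"
  using smooth_fun_differentiable frechet_derivative_works by blast

lemma smooth_fun_continuous:
  assumes "smooth_fun A f"
  shows "continuous_on UNIV f"
  unfolding continuous_on_eq_continuous_within
proof
  fix p
  obtain U \<psi> where c: "(U, \<psi>) \<in> A" "p \<in> U" using obtain_chart .
  have "continuous_on U ((f \<circ> inv_into U \<psi>) \<circ> \<psi>)"
    using smooth_on_imp_continuous_on[OF smooth_funD[OF assms c(1)]] chartD(4)[OF c(1)]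
    by (metis continuous_on_compose)
  then have "continuous_on U f"
    by (rule continuous_on_eq) (simp add: inv_chart[OF c(1)])
  then show "isCont f p" using c chartD(1) continuous_on_eq_continuous_at by blast
qed

definition chart_vector :: "'a set \<Rightarrow> ('a \<Rightarrow> 'e) \<Rightarrow> 'a \<Rightarrow> 'e \<Rightarrow> 'a tangent" where
  "chart_vector U \<psi> p e =
     (\<lambda>f. if smooth_fun A f then frechet_derivative (f \<circ> inv_into U \<psi>) (at (\<psi> p)) e else 0)"

lemma tangent_space_chart_vector:
  "tangent_space A p = {v. \<exists>(U, \<psi>)\<in>A. p \<in> U \<and> (\<exists>e. v = chart_vector U \<psi> p e)}"
  unfolding tangent_space_def chart_vector_def ..

lemma linear_chart_vector:
  assumes "(U, \<psi>) \<in> A" "p \<in> U"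
  shows "linear (chart_vector U \<psi> p)"
proof -
  have "linear (frechet_derivative (f \<circ> inv_into U \<psi>) (at (\<psi> p)))" if "smooth_fun A f" for f
    using smooth_fun_differentiable[OF that assms] linear_frechet_derivative by blast
  then show ?thesis
    by (intro linearI) (auto simp: chart_vector_def fun_eq_iff linear_add linear_cmul)
qed

text \<open>The chain rule for the transition map: a directional derivative in one chart is one in any other chart.\<close>

lemma chart_vector_change:
  assumes U: "(U, \<psi>) \<in> A" "p \<in> U" and V: "(V, \<theta>) \<in> A" "p \<in> V"
  shows "\<exists>e'. chart_vector U \<psi> p e = chart_vector V \<theta> p e'"
proof
  let ?\<tau> = "\<theta> \<circ> inv_into U \<psi>"
  let ?S = "\<psi> ` (U \<inter> V)"
  have S: "open ?S" "\<psi> p \<in> ?S" using open_chart_image[OF U(1) chartD(1)[OF V(1)]] U V by auto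
  have "?\<tau> differentiable at (\<psi> p)"
    using compatible[OF U(1) V(1)] S smooth_on_differentiable_at by blast
  then have t: "(?\<tau> has_derivative frechet_derivative ?\<tau> (at (\<psi> p))) (at (\<psi> p))"
    by (simp add: frechet_derivative_works)
  have tp: "?\<tau> (\<psi> p) = \<theta> p" using inv_chart[OF U] by simp
  show "chart_vector U \<psi> p e = chart_vector V \<theta> p (frechet_derivative ?\<tau> (at (\<psi> p)) e)"
  proof
    fix f
    show "chart_vector U \<psi> p e f = chart_vector V \<theta> p (frechet_derivative ?\<tau> (at (\<psi> p)) e) f"
    proof (cases "smooth_fun A f")
      case True
      let ?F = "f \<circ> inv_into V \<theta>"
      have "(?F has_derivative frechet_derivative ?F (at (\<theta> p))) (at (\<theta> p))"
        using smooth_fun_differentiable[OF True V] by (simp add: frechet_derivative_works)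
      then have "((\<lambda>x. ?F (?\<tau> x)) has_derivative
          (\<lambda>e. frechet_derivative ?F (at (\<theta> p)) (frechet_derivative ?\<tau> (at (\<psi> p)) e))) (at (\<psi> p))"
        using has_derivative_compose[OF t, of ?F] tp by simp
      then have 1: "frechet_derivative (\<lambda>x. ?F (?\<tau> x)) (at (\<psi> p)) =
          (\<lambda>e. frechet_derivative ?F (at (\<theta> p)) (frechet_derivative ?\<tau> (at (\<psi> p)) e))"
        by (metis frechet_derivative_at)
      have 2: "frechet_derivative (f \<circ> inv_into U \<psi>) (at (\<psi> p)) =
          frechet_derivative (\<lambda>x. ?F (?\<tau> x)) (at (\<psi> p))"
        by (rule frechet_derivative_at_cong[OF S])
           (auto simp: inv_chart[OF U(1)] inv_chart[OF V(1)])
      show ?thesis unfolding chart_vector_def using True 1 2 by simp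
    qed (simp add: chart_vector_def)
  qed
qed

text \<open>A single chart around \<open>p\<close> suffices to describe all tangent vectors at \<open>p\<close>. Hence they form a linear
  space, although they are defined by a union over all charts.\<close>

lemma tangent_space_eq_range:
  assumes "(U, \<psi>) \<in> A" "p \<in> U"
  shows "tangent_space A p = range (chart_vector U \<psi> p)"
proof
  show "tangent_space A p \<subseteq> range (chart_vector U \<psi> p)"
    unfolding tangent_space_chart_vector using chart_vector_change[OF _ _ assms] by fastforce
  show "range (chart_vector U \<psi> p) \<subseteq> tangent_space A p"
    unfolding tangent_space_chart_vector using assms by fastforce
qed

lemma subspace_tangent_space: "subspace (tangent_space A p)"
proof -
  obtain U \<psi> where c: "(U, \<psi>) \<in> A" "p \<in> U" using obtain_chart .
  show ?thesis unfolding tangent_space_eq_range[OF c]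
    using linear_subspace_image[OF linear_chart_vector[OF c] subspace_UNIV] .
qed

lemma tangent_not_smooth: "v \<in> tangent_space A p \<Longrightarrow> \<not> smooth_fun A f \<Longrightarrow> v f = 0"
  unfolding tangent_space_def by auto

lemma tangent_const: "v \<in> tangent_space A p \<Longrightarrow> v (\<lambda>q. c) = 0"
  unfolding tangent_space_def by (auto simp: o_def)

lemma tangent_add:
  assumes "v \<in> tangent_space A p" "smooth_fun A f" "smooth_fun A h"
  shows "v (\<lambda>q. f q + h q) = v f + v h"
proof -
  obtain U \<psi> e where c: "(U, \<psi>) \<in> A" "p \<in> U" and v: "v = chart_vector U \<psi> p e"
    using assms(1) unfolding tangent_space_chart_vector by blast
  let ?i = "inv_into U \<psi>"
  have "((\<lambda>x. (f \<circ> ?i) x + (h \<circ> ?i) x) has_derivative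
     (\<lambda>e. frechet_derivative (f \<circ> ?i) (at (\<psi> p)) e + frechet_derivative (h \<circ> ?i) (at (\<psi> p)) e)) (at (\<psi> p))"
    by (rule has_derivative_add[OF smooth_fun_has_derivative[OF assms(2) c]
          smooth_fun_has_derivative[OF assms(3) c]])
  from frechet_derivative_at[OF this] show ?thesis
    unfolding v chart_vector_def using assms(2,3) smooth_fun_add[OF assms(2,3)]
    by (simp add: o_def fun_eq_iff)
qed

lemma tangent_mult:
  assumes "v \<in> tangent_space A p" "smooth_fun A f" "smooth_fun A h"
  shows "v (\<lambda>q. f q * h q) = f p * v h + v f * h p"
proof -
  obtain U \<psi> e where c: "(U, \<psi>) \<in> A" "p \<in> U" and v: "v = chart_vector U \<psi> p e"
    using assms(1) unfolding tangent_space_chart_vector by blast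
  let ?i = "inv_into U \<psi>"
  have "((\<lambda>x. (f \<circ> ?i) x * (h \<circ> ?i) x) has_derivative
     (\<lambda>e. (f \<circ> ?i) (\<psi> p) * frechet_derivative (h \<circ> ?i) (at (\<psi> p)) e +
       frechet_derivative (f \<circ> ?i) (at (\<psi> p)) e * (h \<circ> ?i) (\<psi> p))) (at (\<psi> p))"
    by (rule has_derivative_mult[OF smooth_fun_has_derivative[OF assms(2) c]
          smooth_fun_has_derivative[OF assms(3) c]])
  from frechet_derivative_at[OF this] show ?thesis
    unfolding v chart_vector_def using assms(2,3) smooth_fun_mult[OF assms(2,3)] inv_chart[OF c]
    by (simp add: o_def fun_eq_iff)
qed

lemma tangent_cmult:
  assumes "v \<in> tangent_space A p" "smooth_fun A f"
  shows "v (\<lambda>q. c * f q) = c * v f"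
  using tangent_mult[OF assms(1) smooth_fun_const assms(2), of c] tangent_const[OF assms(1), of c]
  by simp

lemma tangent_uminus:
  assumes "v \<in> tangent_space A p" "smooth_fun A f"
  shows "v (\<lambda>q. - f q) = - v f"
  using tangent_cmult[OF assms, of "-1"] by simp

lemma tangent_diff:
  assumes "v \<in> tangent_space A p" "smooth_fun A f" "smooth_fun A h"
  shows "v (\<lambda>q. f q - h q) = v f - v h"
  using tangent_add[OF assms(1,2) smooth_fun_uminus[OF assms(3)]] tangent_uminus[OF assms(1,3)]
  by simp

section \<open>Extension of functions and tangent vectors\<close>

text \<open>The support is contained in the image of a closed ball, which is compact and therefore closed, the
  manifold being Hausdorff. So the extension vanishes near every point outside the chart domain.\<close>

lemma smooth_fun_extend_by_zero:
  assumes U: "(U, \<psi>) \<in> A" and F: "smooth_on (\<psi> ` U) F" and r: "cball x0 r \<subseteq> \<psi> ` U"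
    and F0: "\<And>x. x \<in> \<psi> ` U \<Longrightarrow> x \<notin> cball x0 r \<Longrightarrow> F x = 0"
  shows "smooth_fun A (\<lambda>q. if q \<in> U then F (\<psi> q) else 0)" (is "smooth_fun A ?f")
  unfolding smooth_fun_def
proof safe
  fix V \<theta> assume V: "(V, \<theta>) \<in> A"
  define K where "K = inv_into U \<psi> ` cball x0 r"
  have "compact K" unfolding K_def
    using compact_continuous_image[OF continuous_on_subset[OF chartD(5)[OF U] r]] by simp
  then have K: "open (- K)" using compact_imp_closed by blast
  have f0: "?f q = 0" if "q \<notin> K" for q
  proof -
    have "\<psi> q \<notin> cball x0 r" if "q \<in> U"
      using that \<open>q \<notin> K\<close> inv_chart[OF U that] unfolding K_def by (metis imageI)
    then show ?thesis using F0 that by (cases "q \<in> U") simp_all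
  qed
  have KU: "K \<subseteq> U" unfolding K_def using r by (auto intro: inv_into_into)
  show "smooth_on (\<theta> ` V) (?f \<circ> inv_into V \<theta>)"
  proof (rule smooth_on_local)
    fix y assume "y \<in> \<theta> ` V"
    then obtain q where q: "q \<in> V" "y = \<theta> q" by blast
    show "\<exists>T. open T \<and> y \<in> T \<and> smooth_on T (?f \<circ> inv_into V \<theta>)"
    proof (cases "q \<in> U")
      case True
      let ?T = "\<theta> ` (V \<inter> U)"
      have T: "open ?T" using open_chart_image[OF V chartD(1)[OF U]] .
      have "smooth_on ?T (\<lambda>x. F ((\<psi> \<circ> inv_into V \<theta>) x))"
        by (rule smooth_on_compose[OF T chartD(2)[OF U] _ compatible[OF V U] F])
           (auto simp: inv_chart[OF V])
      then have "smooth_on ?T (?f \<circ> inv_into V \<theta>)"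
        by (rule smooth_on_cong[OF _ T]) (auto simp: inv_chart[OF V])
      then show ?thesis using T True q by blast
    next
      case False
      let ?T = "\<theta> ` (V \<inter> - K)"
      have T: "open ?T" using open_chart_image[OF V K] .
      have "smooth_on ?T (?f \<circ> inv_into V \<theta>)"
      proof (rule smooth_on_cong[OF smooth_on_const[of _ 0] T])
        show "0 = (?f \<circ> inv_into V \<theta>) x" if xT: "x \<in> ?T" for x
        proof -
          obtain u where u: "u \<in> V" "u \<notin> K" "x = \<theta> u" using xT by blast
          have "(?f \<circ> inv_into V \<theta>) x = ?f u" using inv_chart[OF V u(1)] u(3) by (simp only: o_apply)
          then show ?thesis using f0[OF u(2)] by simp
        qed
      qed
      then show ?thesis using T False q KU by blast
    qed
  qed
qed

lemma exists_chart_bump: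
  assumes c: "(U, \<psi>) \<in> A" "p \<in> U"
  obtains b r where "smooth_on UNIV b" "b (\<psi> p) = (1::real)" "cball (\<psi> p) r \<subseteq> \<psi> ` U"
    "\<And>x. x \<notin> cball (\<psi> p) r \<Longrightarrow> b x = 0"
proof -
  obtain r where r: "r > 0" "cball (\<psi> p) r \<subseteq> \<psi> ` U"
    using chartD(2)[OF c(1)] c(2) open_contains_cball by blast
  obtain b where "smooth_on UNIV b" "b (\<psi> p) = (1::real)" "\<And>x. x \<notin> cball (\<psi> p) r \<Longrightarrow> b x = 0"
    using exists_smooth_bump[OF r(1), of "\<psi> p"] by blast
  then show ?thesis using that r by blast
qed

text \<open>The function is \<open>b \<cdot> ((x - \<psi> p) \<bullet> w)\<close> for a bump function \<open>b\<close>: the second factor vanishes at \<open>\<psi> p\<close>, so only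
  \<open>b (\<psi> p) = 1\<close> enters the derivative there.\<close>

lemma chart_vector_coordinate:
  assumes c: "(U, \<psi>) \<in> A" "p \<in> U"
  obtains f where "smooth_fun A f" "\<And>e. chart_vector U \<psi> p e f = e \<bullet> w"
proof -
  obtain b r where b: "smooth_on UNIV b" "b (\<psi> p) = (1::real)" "cball (\<psi> p) r \<subseteq> \<psi> ` U"
    "\<And>x. x \<notin> cball (\<psi> p) r \<Longrightarrow> b x = 0" by (rule exists_chart_bump[OF c]) (rule that)
  define F where "F x = b x * ((x - \<psi> p) \<bullet> w)" for x
  have F: "smooth_on (\<psi> ` U) F"
    unfolding F_def
    by (intro smooth_on_mult smooth_on_inner_diff chartD(2)[OF c(1)] smooth_on_subset[OF b(1)]) simp
  let ?f = "\<lambda>q. if q \<in> U then F (\<psi> q) else 0"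
  have f: "smooth_fun A ?f"
    using smooth_fun_extend_by_zero[OF c(1) F b(3)] b(4) by (simp add: F_def)
  have "(b has_derivative frechet_derivative b (at (\<psi> p))) (at (\<psi> p))"
    using smooth_on_differentiable_at[OF b(1)] by (simp add: frechet_derivative_works)
  then have "(F has_derivative (\<lambda>e. b (\<psi> p) * ((e - 0) \<bullet> w) +
      frechet_derivative b (at (\<psi> p)) e * ((\<psi> p - \<psi> p) \<bullet> w))) (at (\<psi> p))"
    unfolding F_def
    by (intro has_derivative_mult has_derivative_inner_left has_derivative_diff has_derivative_ident
          has_derivative_const)
  then have "frechet_derivative F (at (\<psi> p)) = (\<lambda>e. e \<bullet> w)"
    using b(2) frechet_derivative_at by fastforce
  moreover have "frechet_derivative (?f \<circ> inv_into U \<psi>) (at (\<psi> p)) = frechet_derivative F (at (\<psi> p))"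
    by (rule frechet_derivative_at_cong[OF chartD(2)[OF c(1)]]) (use c inv_chart[OF c(1)] in auto)
  ultimately have "chart_vector U \<psi> p e ?f = e \<bullet> w" for e
    using f by (simp add: chart_vector_def)
  then show ?thesis using that f by blast
qed

text \<open>Every linear functional on a tangent space is the differential of a global smooth function. Applied to
  a dual basis, it provides functions that detect linear independence of vector fields near a point.\<close>

lemma linear_functional_eq_tangent:
  assumes "linear l"
  obtains f where "smooth_fun A f" "\<And>v. v \<in> tangent_space A p \<Longrightarrow> v f = (l v :: real)"
proof -
  obtain U \<psi> where c: "(U, \<psi>) \<in> A" "p \<in> U" using obtain_chart .
  let ?d = "chart_vector U \<psi> p"
  define w where "w = (\<Sum>b\<in>Basis. l (?d b) *\<^sub>R b)"
  have lin: "linear (l \<circ> ?d)" using linear_compose[OF linear_chart_vector[OF c] assms] .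
  have lw: "l (?d e) = e \<bullet> w" for e
  proof -
    have "(l \<circ> ?d) e = (\<Sum>b\<in>Basis. (e \<bullet> b) *\<^sub>R (l \<circ> ?d) b)"
      using linear_sum[OF lin, of "\<lambda>b. (e \<bullet> b) *\<^sub>R b" Basis]
      by (simp add: euclidean_representation linear_cmul[OF lin, simplified])
    then show ?thesis by (simp add: w_def inner_sum_right mult.commute)
  qed
  obtain f where "smooth_fun A f" "\<And>e. ?d e f = e \<bullet> w" using chart_vector_coordinate[OF c] by blast
  then show ?thesis using that lw unfolding tangent_space_eq_range[OF c] by force
qed

lemma tangent_space_basis:
  obtains B where "finite B" "independent B" "card B = DIM('e)" "span B = tangent_space A p"
proof -
  obtain U \<psi> where c: "(U, \<psi>) \<in> A" "p \<in> U" using obtain_chart .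
  let ?d = "chart_vector U \<psi> p"
  have lin: "linear ?d" using linear_chart_vector[OF c] .
  have inj: "inj ?d"
    unfolding linear_injective_0[OF lin]
  proof (intro allI impI)
    fix e assume "?d e = 0"
    moreover obtain f where "\<And>u. ?d u f = u \<bullet> e" using chart_vector_coordinate[OF c] by blast
    ultimately show "e = 0" by (metis inner_eq_zero_iff zero_fun_apply)
  qed
  show ?thesis
  proof
    show "finite (?d ` Basis)" by simp
    show "independent (?d ` Basis)"
      using linear_independent_injective_image[OF lin independent_Basis] inj_on_subset[OF inj] by blast
    show "card (?d ` Basis) = DIM('e)" using card_image inj_on_subset[OF inj] by blast
    show "span (?d ` Basis) = tangent_space A p"
      by (simp add: linear_span_image[OF lin] tangent_space_eq_range[OF c])
  qed
qed

text \<open>In a chart the extension is the constant field in the direction of the vector, times a bump function.\<close>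

lemma tangent_extension:
  assumes "v \<in> tangent_space A p"
  obtains X where "smooth_vf A X" "X p = v"
proof -
  obtain U \<psi> where c: "(U, \<psi>) \<in> A" "p \<in> U" using obtain_chart .
  obtain e where e: "v = chart_vector U \<psi> p e" using assms unfolding tangent_space_eq_range[OF c] by blast
  obtain b r where b: "smooth_on UNIV b" "b (\<psi> p) = (1::real)" "cball (\<psi> p) r \<subseteq> \<psi> ` U"
    "\<And>x. x \<notin> cball (\<psi> p) r \<Longrightarrow> b x = 0" by (rule exists_chart_bump[OF c]) (rule that)
  let ?X = "\<lambda>q. if q \<in> U then b (\<psi> q) *\<^sub>R chart_vector U \<psi> q e else 0"
  have "?X q \<in> tangent_space A q" for q
    using tangent_space_eq_range[OF c(1), of q] subspace_tangent_space[of q]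
    by (auto intro: subspace_mul subspace_0)
  moreover have "smooth_fun A (\<lambda>q. ?X q f)" if f: "smooth_fun A f" for f
  proof -
    let ?F = "\<lambda>x. b x * frechet_derivative (f \<circ> inv_into U \<psi>) (at x) e"
    have F: "smooth_on (\<psi> ` U) ?F"
      by (intro smooth_on_mult smooth_on_frechet_derivative smooth_funD[OF f c(1)] chartD(2)[OF c(1)]
            smooth_on_subset[OF b(1)]) simp
    have "(\<lambda>q. ?X q f) = (\<lambda>q. if q \<in> U then ?F (\<psi> q) else 0)"
      using f by (auto simp: chart_vector_def fun_eq_iff)
    then show ?thesis using smooth_fun_extend_by_zero[OF c(1) F b(3)] b(4) by simp
  qed
  ultimately have "smooth_vf A ?X" unfolding smooth_vf_def by blast
  moreover have "?X p = v" using c b(2) e by simp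
  ultimately show ?thesis using that by blast
qed

section \<open>Vector fields and the Levi-Civita connection\<close>

lemma smooth_vf_tangent: "smooth_vf A X \<Longrightarrow> X p \<in> tangent_space A p"
  unfolding smooth_vf_def by blast

lemma smooth_vf_smooth_fun: "smooth_vf A X \<Longrightarrow> smooth_fun A f \<Longrightarrow> smooth_fun A (\<lambda>p. X p f)"
  unfolding smooth_vf_def by blast

lemma smooth_vf_add:
  assumes "smooth_vf A X" "smooth_vf A Y" shows "smooth_vf A (X + Y)"
  using assms subspace_add[OF subspace_tangent_space] smooth_fun_add
  unfolding smooth_vf_def by simp

lemma smooth_vf_scaleR_fun:
  assumes "smooth_fun A f" "smooth_vf A X" shows "smooth_vf A (\<lambda>p. f p *\<^sub>R X p)"
  using assms subspace_mul[OF subspace_tangent_space] smooth_fun_mult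
  unfolding smooth_vf_def by simp

lemma smooth_vf_scaleR: "smooth_vf A X \<Longrightarrow> smooth_vf A (c *\<^sub>R X)"
  using smooth_vf_scaleR_fun[OF smooth_fun_const[of c], of X] by (simp add: scaleR_fun_def)

lemma smooth_vf_uminus: "smooth_vf A X \<Longrightarrow> smooth_vf A (- X)"
  using smooth_vf_scaleR[of X "-1"] by simp

lemma smooth_vf_diff: "smooth_vf A X \<Longrightarrow> smooth_vf A Y \<Longrightarrow> smooth_vf A (X - Y)"
  using smooth_vf_add[OF _ smooth_vf_uminus] by fastforce

end

lemma app_apply [simp]: "app T X p = T p (X p)"
  by (simp add: app_def)

locale contact_metric_connection = contact_metric_manifold A n \<phi> \<xi> \<eta> g
  for A :: "('a::{t2_space, second_countable_topology}, 'e::euclidean_space) atlas"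
    and n :: nat and \<phi> :: "'a endo_field" and \<xi> :: "'a vector_field"
    and \<eta> :: "'a one_form" and g :: "'a bilinear_field" +
  fixes D :: "'a vector_field \<Rightarrow> 'a vector_field \<Rightarrow> 'a vector_field"
  assumes connection: "levi_civita A g D"
begin

abbreviation TM :: "'a \<Rightarrow> 'a tangent set" where "TM \<equiv> tangent_space A"

text \<open>Closure and linearity statements about tangent vectors and smooth fields are conditional on membership;
  as simplification rules they let the computations below be done by rewriting.\<close>

lemma tangent_closed [simp]:
  "0 \<in> TM p"
  "v \<in> TM p \<Longrightarrow> w \<in> TM p \<Longrightarrow> v + w \<in> TM p"
  "v \<in> TM p \<Longrightarrow> w \<in> TM p \<Longrightarrow> v - w \<in> TM p"
  "v \<in> TM p \<Longrightarrow> - v \<in> TM p"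
  "v \<in> TM p \<Longrightarrow> c *\<^sub>R v \<in> TM p"
  using subspace_tangent_space[of p]
  by (simp_all add: subspace_0 subspace_add subspace_diff subspace_neg subspace_mul)

lemma phi_tangent [simp]: "v \<in> TM p \<Longrightarrow> \<phi> p v \<in> TM p"
  using phi_smooth unfolding smooth_endo_def by blast

lemma phi_comb:
  "v \<in> TM p \<Longrightarrow> w \<in> TM p \<Longrightarrow> \<phi> p (a *\<^sub>R v + b *\<^sub>R w) = a *\<^sub>R \<phi> p v + b *\<^sub>R \<phi> p w"
  using phi_smooth unfolding smooth_endo_def by blast

lemma phi_linear [simp]:
  "v \<in> TM p \<Longrightarrow> w \<in> TM p \<Longrightarrow> \<phi> p (v + w) = \<phi> p v + \<phi> p w"
  "v \<in> TM p \<Longrightarrow> w \<in> TM p \<Longrightarrow> \<phi> p (v - w) = \<phi> p v - \<phi> p w"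
  "v \<in> TM p \<Longrightarrow> \<phi> p (- v) = - \<phi> p v"
  "v \<in> TM p \<Longrightarrow> \<phi> p (c *\<^sub>R v) = c *\<^sub>R \<phi> p v"
  "\<phi> p 0 = 0"
  using phi_comb[of v p w 1 1] phi_comb[of v p w 1 "-1"] phi_comb[of v p v "-1" 0]
    phi_comb[of v p v c 0] phi_comb[of 0 p 0 0 0] by simp_all

lemma eta_comb:
  "v \<in> TM p \<Longrightarrow> w \<in> TM p \<Longrightarrow> \<eta> p (a *\<^sub>R v + b *\<^sub>R w) = a * \<eta> p v + b * \<eta> p w"
  using eta_smooth unfolding smooth_one_form_def by blast

lemma eta_linear [simp]:
  "v \<in> TM p \<Longrightarrow> w \<in> TM p \<Longrightarrow> \<eta> p (v + w) = \<eta> p v + \<eta> p w"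
  "v \<in> TM p \<Longrightarrow> w \<in> TM p \<Longrightarrow> \<eta> p (v - w) = \<eta> p v - \<eta> p w"
  "v \<in> TM p \<Longrightarrow> \<eta> p (- v) = - \<eta> p v"
  "v \<in> TM p \<Longrightarrow> \<eta> p (c *\<^sub>R v) = c * \<eta> p v"
  "\<eta> p 0 = 0"
  using eta_comb[of v p w 1 1] eta_comb[of v p w 1 "-1"] eta_comb[of v p v "-1" 0]
    eta_comb[of v p v c 0] eta_comb[of 0 p 0 0 0] by simp_all

lemma metric_comb:
  "u \<in> TM p \<Longrightarrow> v \<in> TM p \<Longrightarrow> w \<in> TM p \<Longrightarrow>
     g p (a *\<^sub>R u + b *\<^sub>R v) w = a * g p u w + b * g p v w"
  using metric unfolding riemannian_metric_def by blast

lemma metric_sym: "v \<in> TM p \<Longrightarrow> w \<in> TM p \<Longrightarrow> g p v w = g p w v"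
  using metric unfolding riemannian_metric_def by blast

lemma metric_linear_left [simp]:
  "u \<in> TM p \<Longrightarrow> v \<in> TM p \<Longrightarrow> w \<in> TM p \<Longrightarrow> g p (u + v) w = g p u w + g p v w"
  "u \<in> TM p \<Longrightarrow> v \<in> TM p \<Longrightarrow> w \<in> TM p \<Longrightarrow> g p (u - v) w = g p u w - g p v w"
  "v \<in> TM p \<Longrightarrow> w \<in> TM p \<Longrightarrow> g p (- v) w = - g p v w"
  "v \<in> TM p \<Longrightarrow> w \<in> TM p \<Longrightarrow> g p (c *\<^sub>R v) w = c * g p v w"
  "w \<in> TM p \<Longrightarrow> g p 0 w = 0"
  using metric_comb[of u p v w 1 1] metric_comb[of u p v w 1 "-1"] metric_comb[of v p v w "-1" 0]
    metric_comb[of v p v w c 0] metric_comb[of 0 p 0 w 0 0] by simp_all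

lemma metric_linear_right [simp]:
  "u \<in> TM p \<Longrightarrow> v \<in> TM p \<Longrightarrow> w \<in> TM p \<Longrightarrow> g p w (u + v) = g p w u + g p w v"
  "u \<in> TM p \<Longrightarrow> v \<in> TM p \<Longrightarrow> w \<in> TM p \<Longrightarrow> g p w (u - v) = g p w u - g p w v"
  "v \<in> TM p \<Longrightarrow> w \<in> TM p \<Longrightarrow> g p w (- v) = - g p w v"
  "v \<in> TM p \<Longrightarrow> w \<in> TM p \<Longrightarrow> g p w (c *\<^sub>R v) = c * g p w v"
  "w \<in> TM p \<Longrightarrow> g p w 0 = 0"
  using metric_linear_left by (simp_all add: metric_sym[of w p])

lemma metric_pos: "v \<in> TM p \<Longrightarrow> v \<noteq> 0 \<Longrightarrow> g p v v > 0"
  using metric unfolding riemannian_metric_def by blast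

lemma metric_nonneg: "v \<in> TM p \<Longrightarrow> g p v v \<ge> 0"
  using metric_pos[of v p] by (cases "v = 0") (auto simp: less_imp_le)

lemma metric_eqI:
  assumes "v \<in> TM p" "w \<in> TM p" "\<And>u. u \<in> TM p \<Longrightarrow> g p u v = g p u w"
  shows "v = w"
proof (rule ccontr)
  assume "v \<noteq> w"
  then have "g p (v - w) (v - w) > 0" using metric_pos[of "v - w" p] assms by simp
  moreover have "g p (v - w) v = g p (v - w) w" using assms by simp
  ultimately show False using assms(1,2) by simp
qed

lemma smooth_fun_metric [simp]:
  "smooth_vf A X \<Longrightarrow> smooth_vf A Y \<Longrightarrow> smooth_fun A (\<lambda>p. g p (X p) (Y p))"
  using metric unfolding riemannian_metric_def by blast

lemma smooth_fun_eta [simp]: "smooth_vf A X \<Longrightarrow> smooth_fun A (app \<eta> X)"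
  using eta_smooth unfolding smooth_one_form_def by blast

lemma smooth_vf_phi [simp]: "smooth_vf A X \<Longrightarrow> smooth_vf A (app \<phi> X)"
  using phi_smooth unfolding smooth_endo_def by blast

declare xi_smooth [simp] smooth_vf_add [simp] smooth_vf_diff [simp] smooth_vf_uminus [simp]
  smooth_vf_scaleR [simp] smooth_vf_scaleR_fun [simp] smooth_vf_tangent [simp]
  smooth_vf_smooth_fun [simp] smooth_fun_const [simp] smooth_fun_add [simp] smooth_fun_mult [simp]
  smooth_fun_diff [simp] smooth_fun_uminus [simp] eta_xi [simp]

lemma eta_xi_field: "app \<eta> \<xi> = (\<lambda>q. 1)"
  by (simp add: app_def)

lemma smooth_vf_D [simp]: "smooth_vf A X \<Longrightarrow> smooth_vf A Y \<Longrightarrow> smooth_vf A (D X Y)"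
  using connection[unfolded levi_civita_def, THEN conjunct1] by simp

lemma D_add [simp]:
  "smooth_vf A X \<Longrightarrow> smooth_vf A Y \<Longrightarrow> smooth_vf A Z \<Longrightarrow> D (X + Y) Z = D X Z + D Y Z"
  "smooth_vf A X \<Longrightarrow> smooth_vf A Y \<Longrightarrow> smooth_vf A Z \<Longrightarrow> D X (Y + Z) = D X Y + D X Z"
  using connection unfolding levi_civita_def by blast+

lemma D_scaleR_fun:
  "smooth_fun A f \<Longrightarrow> smooth_vf A X \<Longrightarrow> smooth_vf A Y \<Longrightarrow>
     D (\<lambda>p. f p *\<^sub>R X p) Y = (\<lambda>p. f p *\<^sub>R D X Y p)"
  "smooth_fun A f \<Longrightarrow> smooth_vf A X \<Longrightarrow> smooth_vf A Y \<Longrightarrow>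
     D X (\<lambda>p. f p *\<^sub>R Y p) = (\<lambda>p. X p f *\<^sub>R Y p + f p *\<^sub>R D X Y p)"
  using connection unfolding levi_civita_def by blast+

lemma D_scaleR [simp]:
  assumes "smooth_vf A X" "smooth_vf A Y"
  shows "D (c *\<^sub>R X) Y = c *\<^sub>R D X Y" "D X (c *\<^sub>R Y) = c *\<^sub>R D X Y"
proof -
  have e: "c *\<^sub>R Z = (\<lambda>p. c *\<^sub>R Z p)" for Z :: "'a vector_field"
    by (rule ext) simp
  show "D (c *\<^sub>R X) Y = c *\<^sub>R D X Y" "D X (c *\<^sub>R Y) = c *\<^sub>R D X Y"
    unfolding e using D_scaleR_fun[OF smooth_fun_const[of c] assms]
      tangent_const[OF smooth_vf_tangent[OF assms(1)]] by simp_all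
qed

lemma D_uminus [simp]:
  "smooth_vf A X \<Longrightarrow> smooth_vf A Y \<Longrightarrow> D (- X) Y = - D X Y"
  "smooth_vf A X \<Longrightarrow> smooth_vf A Y \<Longrightarrow> D X (- Y) = - D X Y"
  using D_scaleR[of X Y "-1"] by simp_all

lemma D_diff [simp]:
  "smooth_vf A X \<Longrightarrow> smooth_vf A Y \<Longrightarrow> smooth_vf A Z \<Longrightarrow> D (X - Y) Z = D X Z - D Y Z"
  "smooth_vf A X \<Longrightarrow> smooth_vf A Y \<Longrightarrow> smooth_vf A Z \<Longrightarrow> D X (Y - Z) = D X Y - D X Z"
  using D_add(1)[of X "- Y" Z] D_add(2)[of X Y "- Z"] by simp_all

lemma bracket_eq_D:
  "smooth_vf A X \<Longrightarrow> smooth_vf A Y \<Longrightarrow> bracket X Y = D X Y - D Y X"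
  using connection unfolding levi_civita_def by metis

lemma metric_D:
  "smooth_vf A X \<Longrightarrow> smooth_vf A Y \<Longrightarrow> smooth_vf A Z \<Longrightarrow>
     X p (\<lambda>q. g q (Y q) (Z q)) = g p (D X Y p) (Z p) + g p (Y p) (D X Z p)"
  using connection unfolding levi_civita_def by blast

lemma smooth_vf_bracket [simp]: "smooth_vf A X \<Longrightarrow> smooth_vf A Y \<Longrightarrow> smooth_vf A (bracket X Y)"
  by (simp add: bracket_eq_D)

lemma bracket_skew: "bracket Y X = - bracket X Y"
  by (simp add: bracket_def fun_eq_iff)

lemma bracket_apply: "bracket X Y p f = X p (\<lambda>q. Y q f) - Y p (\<lambda>q. X q f)"
  by (simp add: bracket_def)

text \<open>On smooth functions this is the Jacobi identity for commutators of operators. On other functions both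
  sides are 0 because tangent vectors are extended by 0.\<close>

lemma jacobi:
  assumes [simp]: "smooth_vf A X" "smooth_vf A Y" "smooth_vf A Z"
  shows "bracket X (bracket Y Z) p = bracket (bracket X Y) Z p + bracket Y (bracket X Z) p"
proof
  fix f
  show "bracket X (bracket Y Z) p f = (bracket (bracket X Y) Z p + bracket Y (bracket X Z) p) f"
  proof (cases "smooth_fun A f")
    case True
    have sf: "smooth_fun A (\<lambda>q. V q (\<lambda>q. W q f))" if "smooth_vf A V" "smooth_vf A W" for V W
      using smooth_vf_smooth_fun[OF that(1) smooth_vf_smooth_fun[OF that(2) True]] .
    have d: "U p (\<lambda>q. V q (\<lambda>q. W q f) - W q (\<lambda>q. V q f)) =
        U p (\<lambda>q. V q (\<lambda>q. W q f)) - U p (\<lambda>q. W q (\<lambda>q. V q f))"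
      if "smooth_vf A U" "smooth_vf A V" "smooth_vf A W" for U V W
      using tangent_diff[OF smooth_vf_tangent[OF that(1)] sf[OF that(2,3)] sf[OF that(3,2)]] .
    show ?thesis
      using d[of X Y Z] d[of Y X Z] d[of Z X Y] by (simp add: bracket_apply)
  next
    case False
    have *: "smooth_vf A (bracket X (bracket Y Z))" "smooth_vf A (bracket (bracket X Y) Z)"
      "smooth_vf A (bracket Y (bracket X Z))" by simp_all
    show ?thesis
      using tangent_not_smooth[OF smooth_vf_tangent[OF *(1)] False]
        tangent_not_smooth[OF smooth_vf_tangent[OF *(2)] False]
        tangent_not_smooth[OF smooth_vf_tangent[OF *(3)] False] by simp
  qed
qed

section \<open>Contact metric manifolds: the tensor h and the derivative of \<open>\<xi>\<close>\<close>

lemma contact: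
  assumes "smooth_vf A X" "smooth_vf A Y"
  shows "2 * g p (X p) (\<phi> p (Y p)) = X p (app \<eta> Y) - Y p (app \<eta> X) - \<eta> p (bracket X Y p)"
  using contact_metric[OF assms, of p] by (simp add: ext_deriv_def)

lemma phi_skew:
  assumes "v \<in> TM p" "w \<in> TM p"
  shows "g p (\<phi> p v) w = - g p v (\<phi> p w)"
proof -
  obtain X where X: "smooth_vf A X" "X p = v" using tangent_extension[OF assms(1)] .
  obtain Y where Y: "smooth_vf A Y" "Y p = w" using tangent_extension[OF assms(2)] .
  have "g p v (\<phi> p w) = - g p w (\<phi> p v)"
    using contact[OF X(1) Y(1), of p] contact[OF Y(1) X(1), of p] X Y bracket_skew[of Y X]
    by simp
  then show ?thesis using metric_sym[of "\<phi> p v" p w] assms by simp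
qed

lemma phi_xi [simp]: "\<phi> p (\<xi> p) = 0"
proof -
  have "g p (\<phi> p (\<xi> p)) (\<phi> p (\<xi> p)) = 0"
    using phi_skew[of "\<xi> p" p "\<phi> p (\<xi> p)"] phi_square[of "\<xi> p" p] by simp
  then show ?thesis using metric_pos[of "\<phi> p (\<xi> p)" p] by force
qed

lemma metric_xi [simp]:
  "v \<in> TM p \<Longrightarrow> g p v (\<xi> p) = \<eta> p v"
  "v \<in> TM p \<Longrightarrow> g p (\<xi> p) v = \<eta> p v"
  using compatible_metric[of v p "\<xi> p"] metric_sym[of "\<xi> p" p v] by simp_all

lemma eta_phi [simp]: "v \<in> TM p \<Longrightarrow> \<eta> p (\<phi> p v) = 0"
  using phi_skew[of v p "\<xi> p"] by simp

lemma phi_phi [simp]: "v \<in> TM p \<Longrightarrow> \<phi> p (\<phi> p v) = \<eta> p v *\<^sub>R \<xi> p - v"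
  by (simp add: phi_square)

lemma phi_phi_field:
  "smooth_vf A X \<Longrightarrow> app \<phi> (app \<phi> X) = (\<lambda>p. app \<eta> X p *\<^sub>R \<xi> p) - X"
  by (simp add: fun_eq_iff)

text \<open>The invariance of \<open>\<eta>\<close> under the flow of \<open>\<xi>\<close>, a consequence of \<open>d\<eta>(\<xi>, \<cdot>) = g(\<xi>, \<phi> \<cdot>) = 0\<close>.\<close>

lemma xi_eta:
  assumes "smooth_vf A X"
  shows "\<xi> p (app \<eta> X) = \<eta> p (bracket \<xi> X p)"
  using contact[OF xi_smooth assms, of p] assms
  by (simp add: eta_xi_field tangent_const[of "X p" p])

lemma D_xi_xi [simp]: "D \<xi> \<xi> = 0"
proof
  fix p
  have "D \<xi> \<xi> p = 0"
  proof (rule metric_eqI)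
    fix v assume v: "v \<in> TM p"
    obtain X where X: "smooth_vf A X" "X p = v" using tangent_extension[OF v] .
    have "\<xi> p (app \<eta> X) = g p (D \<xi> \<xi> p) (X p) + \<eta> p (D \<xi> X p)"
      using metric_D[OF xi_smooth xi_smooth X(1), of p] X(1) by (simp add: app_def)
    moreover have "2 * \<eta> p (D X \<xi> p) = 0"
      using metric_D[OF X(1) xi_smooth xi_smooth, of p] X(1) by (simp add: tangent_const[of "X p" p])
    ultimately show "g p v (D \<xi> \<xi> p) = g p v 0"
      using xi_eta[OF X(1), of p] X v by (simp add: bracket_eq_D metric_sym[of v p])
  qed simp_all
  then show "D \<xi> \<xi> p = 0 p" by simp
qed

text \<open>The exterior derivative of the form dual to \<open>\<xi>\<close> is the skew part of \<open>X \<mapsto> D\<^sub>X \<xi>\<close>.\<close>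

lemma D_xi_skew_part:
  assumes [simp]: "smooth_vf A X" "smooth_vf A Y"
  shows "g p (D X \<xi> p) (Y p) - g p (X p) (D Y \<xi> p) = 2 * g p (X p) (\<phi> p (Y p))"
proof -
  have "X p (app \<eta> Y) = g p (D X \<xi> p) (Y p) + \<eta> p (D X Y p)"
    using metric_D[OF _ xi_smooth, of X Y p] by (simp add: app_def)
  moreover have "Y p (app \<eta> X) = g p (D Y \<xi> p) (X p) + \<eta> p (D Y X p)"
    using metric_D[OF _ xi_smooth, of Y X p] by (simp add: app_def)
  ultimately show ?thesis
    using contact[of X Y p] by (simp add: bracket_eq_D metric_sym[of "X p" p "D Y \<xi> p"])
qed

lemma deriv_contact:
  assumes [simp]: "smooth_vf A X" "smooth_vf A Y" "smooth_vf A Z"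
  shows "2 * X p (\<lambda>q. g q (Y q) (\<phi> q (Z q))) =
    X p (\<lambda>q. Y q (app \<eta> Z)) - X p (\<lambda>q. Z q (app \<eta> Y)) - X p (app \<eta> (bracket Y Z))"
proof -
  have sf: "smooth_fun A (\<lambda>q. g q (Y q) (\<phi> q (Z q)))" using smooth_fun_metric[of Y "app \<phi> Z"] by simp
  have "(\<lambda>q. 2 * g q (Y q) (\<phi> q (Z q))) =
      (\<lambda>q. Y q (app \<eta> Z) - Z q (app \<eta> Y) - app \<eta> (bracket Y Z) q)"
    by (rule ext) (simp add: contact)
  then have "2 * X p (\<lambda>q. g q (Y q) (\<phi> q (Z q))) =
     X p (\<lambda>q. Y q (app \<eta> Z) - Z q (app \<eta> Y) - app \<eta> (bracket Y Z) q)"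
    using tangent_cmult[OF smooth_vf_tangent[of X] sf, of p 2] by simp
  also have "\<dots> = X p (\<lambda>q. Y q (app \<eta> Z)) - X p (\<lambda>q. Z q (app \<eta> Y)) - X p (app \<eta> (bracket Y Z))"
    using tangent_diff[OF smooth_vf_tangent[of X p]] by (simp del: app_apply)
  finally show ?thesis .
qed

text \<open>The Lie derivative along \<open>\<xi>\<close> commutes with \<open>d\<close>, so \<open>xi_eta\<close> carries over to \<open>d\<eta>\<close>.\<close>

lemma lie_deriv_dEta:
  assumes [simp]: "smooth_vf A X" "smooth_vf A Y"
  shows "\<xi> p (\<lambda>q. g q (X q) (\<phi> q (Y q))) =
     g p (bracket \<xi> X p) (\<phi> p (Y p)) + g p (X p) (\<phi> p (bracket \<xi> Y p))"
proof -
  have 1: "2 * \<xi> p (\<lambda>q. g q (X q) (\<phi> q (Y q))) =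
     \<xi> p (\<lambda>q. X q (app \<eta> Y)) - \<xi> p (\<lambda>q. Y q (app \<eta> X)) - \<xi> p (app \<eta> (bracket X Y))"
    by (rule deriv_contact) simp_all
  have xe: "(\<lambda>q. \<xi> q (app \<eta> Z)) = app \<eta> (bracket \<xi> Z)" if "smooth_vf A Z" for Z
    using xi_eta[OF that] by (simp add: fun_eq_iff)
  have 2: "\<xi> p (\<lambda>q. X q (app \<eta> Y)) = bracket \<xi> X p (app \<eta> Y) + X p (app \<eta> (bracket \<xi> Y))"
    using bracket_apply[of \<xi> X p "app \<eta> Y"] by (simp add: xe)
  have 3: "\<xi> p (\<lambda>q. Y q (app \<eta> X)) = bracket \<xi> Y p (app \<eta> X) + Y p (app \<eta> (bracket \<xi> X))"
    using bracket_apply[of \<xi> Y p "app \<eta> X"] by (simp add: xe)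
  have 4: "\<xi> p (app \<eta> (bracket X Y)) =
     \<eta> p (bracket (bracket \<xi> X) Y p) + \<eta> p (bracket X (bracket \<xi> Y) p)"
    by (simp add: xi_eta jacobi[of \<xi>])
  show ?thesis
    using 1 2 3 4 contact[of "bracket \<xi> X" Y p] contact[of X "bracket \<xi> Y" p] by simp
qed

text \<open>The value of \<open>h\<close> on a field, before tensoriality is known. Unlike the pointwise tensor, it can be
  differentiated and is visibly smooth.\<close>

definition lie_h :: "'a vector_field \<Rightarrow> 'a vector_field" where
  "lie_h X = (1/2) *\<^sub>R (bracket \<xi> (app \<phi> X) - app \<phi> (bracket \<xi> X))"

lemma smooth_vf_lie_h [simp]: "smooth_vf A X \<Longrightarrow> smooth_vf A (lie_h X)"
  by (simp add: lie_h_def)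

text \<open>Comparing \<open>lie_deriv_dEta\<close> with the derivative of \<open>g\<close> along \<open>\<xi>\<close> eliminates all derivatives of \<open>Y\<close>: the
  right-hand side of the first identity depends on \<open>Y\<close> only through its value at \<open>p\<close>. This is the
  tensoriality of \<open>h\<close>. The second identity expresses \<open>h\<close> by the derivative of \<open>\<xi>\<close>.\<close>

lemma metric_lie_h:
  assumes [simp]: "smooth_vf A X" "smooth_vf A Y"
  shows "g p (X p) (lie_h Y p) = g p (X p) (\<phi> p (\<phi> p (Y p))) - g p (D X \<xi> p) (\<phi> p (Y p))"
    "g p (X p) (lie_h Y p) = - g p (X p) (\<phi> p (\<phi> p (Y p))) - g p (X p) (D (app \<phi> Y) \<xi> p)"
proof -
  have "g p (D \<xi> X p) (\<phi> p (Y p)) + g p (X p) (D \<xi> (app \<phi> Y) p) =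
     g p (bracket \<xi> X p) (\<phi> p (Y p)) + g p (X p) (\<phi> p (bracket \<xi> Y p))"
    using metric_D[OF xi_smooth, of X "app \<phi> Y" p] lie_deriv_dEta[of X Y p] by simp
  moreover have "2 * g p (X p) (lie_h Y p) =
     g p (X p) (bracket \<xi> (app \<phi> Y) p) - g p (X p) (\<phi> p (bracket \<xi> Y p))"
    by (simp add: lie_h_def)
  moreover have "g p (D X \<xi> p) (\<phi> p (Y p)) - g p (X p) (D (app \<phi> Y) \<xi> p) =
     2 * g p (X p) (\<phi> p (\<phi> p (Y p)))"
    using D_xi_skew_part[of X "app \<phi> Y" p] by simp
  ultimately show "g p (X p) (lie_h Y p) = g p (X p) (\<phi> p (\<phi> p (Y p))) - g p (D X \<xi> p) (\<phi> p (Y p))"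
    "g p (X p) (lie_h Y p) = - g p (X p) (\<phi> p (\<phi> p (Y p))) - g p (X p) (D (app \<phi> Y) \<xi> p)"
    by (simp_all add: bracket_eq_D del: phi_phi)
qed

definition h :: "'a endo_field" where "h = h_tensor A \<phi> \<xi>"

text \<open>The value chosen in the definition of the Lie derivative of \<open>\<phi>\<close> exists and is unique because two
  extensions of the same vector have the same \<open>lie_h\<close> there, by \<open>metric_lie_h\<close>.\<close>

lemma h_lie_h:
  assumes X: "smooth_vf A X"
  shows "h p (X p) = lie_h X p"
proof -
  have eq: "lie_h Y p = lie_h X p" if Y: "smooth_vf A Y" "Y p = X p" for Y
  proof (rule metric_eqI)
    fix v assume "v \<in> TM p"
    then obtain Z where Z: "smooth_vf A Z" "Z p = v" using tangent_extension by blast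
    show "g p v (lie_h Y p) = g p v (lie_h X p)"
      using metric_lie_h(1)[OF Z(1) Y(1), of p] metric_lie_h(1)[OF Z(1) X, of p] Y Z by simp
  qed (use X Y in simp_all)
  have "lie_deriv_endo A \<xi> \<phi> p (X p) = (bracket \<xi> (app \<phi> X) - app \<phi> (bracket \<xi> X)) p"
    unfolding lie_deriv_endo_def
  proof (rule the_equality)
    show "\<forall>Y. smooth_vf A Y \<and> Y p = X p \<longrightarrow>
       (bracket \<xi> (app \<phi> X) - app \<phi> (bracket \<xi> X)) p = (bracket \<xi> (app \<phi> Y) - app \<phi> (bracket \<xi> Y)) p"
      using eq unfolding lie_h_def by fastforce
  qed (use X in blast)
  then show ?thesis unfolding h_def h_tensor_def lie_h_def by simp
qed

lemma h_tangent [simp]: "v \<in> TM p \<Longrightarrow> h p v \<in> TM p"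
  by (metis tangent_extension h_lie_h smooth_vf_lie_h smooth_vf_tangent)

lemma app_h: "smooth_vf A X \<Longrightarrow> app h X = lie_h X"
  using h_lie_h by (simp add: fun_eq_iff)

lemma smooth_vf_h [simp]: "smooth_vf A X \<Longrightarrow> smooth_vf A (app h X)"
  by (simp add: app_h)

lemma bracket_linear:
  assumes [simp]: "smooth_vf A X" "smooth_vf A Y" "smooth_vf A Z"
  shows "bracket Z (a *\<^sub>R X + b *\<^sub>R Y) = a *\<^sub>R bracket Z X + b *\<^sub>R bracket Z Y"
  by (simp add: bracket_eq_D scaleR_diff_right)

lemma h_comb:
  assumes v: "v \<in> TM p" and w: "w \<in> TM p"
  shows "h p (a *\<^sub>R v + b *\<^sub>R w) = a *\<^sub>R h p v + b *\<^sub>R h p w"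
proof -
  obtain X where X [simp]: "smooth_vf A X" "X p = v" using tangent_extension[OF v] .
  obtain Y where Y [simp]: "smooth_vf A Y" "Y p = w" using tangent_extension[OF w] .
  have phi: "app \<phi> (a *\<^sub>R X + b *\<^sub>R Y) = a *\<^sub>R app \<phi> X + b *\<^sub>R app \<phi> Y"
    by (simp add: fun_eq_iff)
  have "h p (a *\<^sub>R v + b *\<^sub>R w) = lie_h (a *\<^sub>R X + b *\<^sub>R Y) p"
    using h_lie_h[of "a *\<^sub>R X + b *\<^sub>R Y" p] by simp
  also have "\<dots> = a *\<^sub>R lie_h X p + b *\<^sub>R lie_h Y p"
    by (simp add: lie_h_def phi bracket_linear algebra_simps)
  also have "\<dots> = a *\<^sub>R h p v + b *\<^sub>R h p w"
    using h_lie_h[of X p] h_lie_h[of Y p] by simp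
  finally show ?thesis .
qed

lemma h_linear [simp]:
  "v \<in> TM p \<Longrightarrow> w \<in> TM p \<Longrightarrow> h p (v + w) = h p v + h p w"
  "v \<in> TM p \<Longrightarrow> w \<in> TM p \<Longrightarrow> h p (v - w) = h p v - h p w"
  "v \<in> TM p \<Longrightarrow> h p (- v) = - h p v"
  "v \<in> TM p \<Longrightarrow> h p (c *\<^sub>R v) = c *\<^sub>R h p v"
  "h p 0 = 0"
  using h_comb[of v p w 1 1] h_comb[of v p w 1 "-1"] h_comb[of v p v "-1" 0]
    h_comb[of v p v c 0] h_comb[of 0 p 0 0 0] by simp_all

lemma h_xi [simp]: "h p (\<xi> p) = 0"
proof -
  have "app \<phi> \<xi> = 0" "bracket \<xi> \<xi> = 0" by (simp_all add: fun_eq_iff bracket_def)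
  moreover have "bracket \<xi> 0 = 0"
    using bracket_linear[of \<xi> \<xi> \<xi> 0 0] by simp
  ultimately show ?thesis using h_lie_h[of \<xi> p] by (simp add: lie_h_def)
qed

text \<open>The Lie derivative along \<open>\<xi>\<close> of \<open>\<phi>\<^sup>2 = - I + \<eta> \<otimes> \<xi>\<close> vanishes, since those of \<open>\<eta>\<close> and \<open>\<xi>\<close> do.\<close>

lemma h_phi [simp]:
  assumes v: "v \<in> TM p"
  shows "h p (\<phi> p v) = - \<phi> p (h p v)"
proof -
  obtain X where X [simp]: "smooth_vf A X" "X p = v" using tangent_extension[OF v] .
  have "bracket \<xi> (app \<phi> (app \<phi> X)) p = \<xi> p (app \<eta> X) *\<^sub>R \<xi> p - bracket \<xi> X p"
    by (simp add: phi_phi_field bracket_eq_D D_scaleR_fun algebra_simps del: app_apply)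
  then have "bracket \<xi> (app \<phi> (app \<phi> X)) p = \<phi> p (\<phi> p (bracket \<xi> X p))"
    by (simp add: xi_eta)
  then have "lie_h (app \<phi> X) p + \<phi> p (lie_h X p) = 0"
    by (simp add: lie_h_def scaleR_diff_right del: phi_phi)
  then show ?thesis
    using h_lie_h[of X p] h_lie_h[of "app \<phi> X" p] by (simp add: add_eq_0_iff)
qed

lemma eta_h [simp]:
  assumes v: "v \<in> TM p"
  shows "\<eta> p (h p v) = 0"
proof -
  have "h p v = - h p (\<phi> p (\<phi> p v))" using v by (simp del: h_phi)
  also have "\<dots> = \<phi> p (h p (\<phi> p v))" using v by (simp del: phi_phi)
  finally show ?thesis using v by (simp del: h_phi)
qed

text \<open>The second identity of \<open>metric_lie_h\<close> gives the derivative of \<open>\<xi>\<close> along \<open>\<phi> Y\<close>. Taking \<open>Y = \<phi> X\<close> covers every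
  direction, since \<open>\<phi>\<^sup>2 X\<close> differs from \<open>- X\<close> by a multiple of \<open>\<xi>\<close>, along which \<open>\<xi>\<close> is parallel.\<close>

lemma D_xi:
  assumes [simp]: "smooth_vf A X"
  shows "D X \<xi> p = - \<phi> p (X p) - \<phi> p (h p (X p))"
proof -
  have *: "D (app \<phi> Y) \<xi> p = - \<phi> p (\<phi> p (Y p)) - h p (Y p)" if [simp]: "smooth_vf A Y" for Y
  proof (rule metric_eqI)
    fix v assume v [simp]: "v \<in> TM p"
    then obtain Z where Z: "smooth_vf A Z" "Z p = v" using tangent_extension by blast
    show "g p v (D (app \<phi> Y) \<xi> p) = g p v (- \<phi> p (\<phi> p (Y p)) - h p (Y p))"
      using metric_lie_h(2)[OF Z(1), of Y p] Z by (simp add: h_lie_h del: phi_phi)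
  qed simp_all
  have "D (app \<phi> (app \<phi> X)) \<xi> p = - D X \<xi> p"
    by (simp add: phi_phi_field D_scaleR_fun del: app_apply)
  then have "D X \<xi> p = \<phi> p (\<phi> p (\<phi> p (X p))) + h p (\<phi> p (X p))" using *[of "app \<phi> X"]
    by (simp del: phi_phi h_phi add: algebra_simps minus_equation_iff)
  then show ?thesis by simp
qed

lemma D_xi_field:
  "smooth_vf A X \<Longrightarrow> D X \<xi> = - app \<phi> X - app \<phi> (app h X)"
  by (simp add: D_xi fun_eq_iff[where g = "- app \<phi> X - app \<phi> (app h X)"])

lemma h_sym:
  assumes v: "v \<in> TM p" and w: "w \<in> TM p"
  shows "g p (h p v) w = g p v (h p w)"
proof -
  obtain X where X [simp]: "smooth_vf A X" "X p = v" using tangent_extension[OF v] .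
  obtain Y where Y [simp]: "smooth_vf A Y" "Y p = w" using tangent_extension[OF w] .
  have "g p v (h p w) = g p v (\<phi> p (\<phi> p w)) + g p (\<phi> p v) (\<phi> p w) + g p (\<phi> p (h p v)) (\<phi> p w)"
    using metric_lie_h(1)[of X Y p] h_lie_h[of Y p] v w by (simp add: D_xi del: phi_phi)
  also have "\<dots> = g p (h p v) w"
    using phi_skew[of v p "\<phi> p w"] v w by (simp add: compatible_metric)
  finally show ?thesis by simp
qed

text \<open>The tensor \<open>\<phi>\<close> is parallel along \<open>\<xi>\<close>: by \<open>D_xi\<close> the commutator of \<open>X \<mapsto> D\<^sub>X \<xi>\<close> with \<open>\<phi>\<close>, by which covariant
  and Lie derivative of \<open>\<phi>\<close> along \<open>\<xi>\<close> differ, cancels \<open>2 h\<close>.\<close>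

lemma D_xi_phi:
  assumes [simp]: "smooth_vf A X"
  shows "D \<xi> (app \<phi> X) p = \<phi> p (D \<xi> X p)"
proof -
  have "2 *\<^sub>R h p (X p) = D \<xi> (app \<phi> X) p - D (app \<phi> X) \<xi> p - \<phi> p (D \<xi> X p - D X \<xi> p)"
    by (simp add: h_lie_h lie_h_def bracket_eq_D)
  then show ?thesis by (simp add: D_xi scaleR_2 algebra_simps)
qed

section \<open>The covariant derivative of \<open>\<phi>\<close>\<close>

definition nabla_phi :: "'a vector_field \<Rightarrow> 'a vector_field \<Rightarrow> 'a vector_field" where
  "nabla_phi X Y = D X (app \<phi> Y) - app \<phi> (D X Y)"

lemma smooth_vf_nabla_phi [simp]:
  "smooth_vf A X \<Longrightarrow> smooth_vf A Y \<Longrightarrow> smooth_vf A (nabla_phi X Y)"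
  by (simp add: nabla_phi_def)

definition cov_phi :: "'a vector_field \<Rightarrow> 'a vector_field \<Rightarrow> 'a vector_field \<Rightarrow> 'a \<Rightarrow> real" where
  "cov_phi X Y Z p = g p (nabla_phi X Y p) (Z p)"

lemma cov_phi_skew:
  assumes [simp]: "smooth_vf A X" "smooth_vf A Y" "smooth_vf A Z"
  shows "cov_phi X Y Z p = - cov_phi X Z Y p"
proof -
  have sf: "smooth_fun A (\<lambda>q. g q (Y q) (\<phi> q (Z q)))" using smooth_fun_metric[of Y "app \<phi> Z"] by simp
  have "(\<lambda>q. g q (\<phi> q (Y q)) (Z q)) = (\<lambda>q. - g q (Y q) (\<phi> q (Z q)))"
    by (simp add: phi_skew)
  then have "X p (\<lambda>q. g q (\<phi> q (Y q)) (Z q)) = - X p (\<lambda>q. g q (Y q) (\<phi> q (Z q)))"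
    using tangent_uminus[OF smooth_vf_tangent[of X] sf, of p] by simp
  then have "g p (D X (app \<phi> Y) p) (Z p) + g p (\<phi> p (Y p)) (D X Z p) =
     - (g p (D X Y p) (\<phi> p (Z p)) + g p (Y p) (D X (app \<phi> Z) p))"
    using metric_D[of X "app \<phi> Y" Z p] metric_D[of X Y "app \<phi> Z" p] by simp
  then show ?thesis
    by (simp add: cov_phi_def nabla_phi_def phi_skew[of "D X Y p"] phi_skew[of "D X Z p"]
        metric_sym[of "\<phi> p (Y p)" p "D X Z p"] metric_sym[of "Y p" p] )
qed

text \<open>The identity \<open>d\<^sup>2\<eta> = 0\<close>, written with \<open>d\<eta> = g(\<cdot>, \<phi> \<cdot>)\<close>; all second derivatives cancel in the cyclic sum, and
  what remains of the brackets is the Jacobi identity.\<close>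

lemma contact_form_closed:
  assumes [simp]: "smooth_vf A X" "smooth_vf A Y" "smooth_vf A Z"
  shows "X p (\<lambda>q. g q (Y q) (\<phi> q (Z q))) + Y p (\<lambda>q. g q (Z q) (\<phi> q (X q))) +
      Z p (\<lambda>q. g q (X q) (\<phi> q (Y q))) =
    g p (bracket X Y p) (\<phi> p (Z p)) + g p (bracket Y Z p) (\<phi> p (X p)) +
      g p (bracket Z X p) (\<phi> p (Y p))"
proof -
  have j: "\<eta> p (bracket (bracket X Y) Z p) + \<eta> p (bracket (bracket Y Z) X p) +
      \<eta> p (bracket (bracket Z X) Y p) = 0"
    using arg_cong[OF jacobi[of X Y Z p], where f = "\<eta> p"] by (simp add: bracket_eq_D)
  have b: "bracket U V p f = U p (\<lambda>q. V q f) - V p (\<lambda>q. U q f)" for U V f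
    by (rule bracket_apply)
  show ?thesis
    using deriv_contact[of X Y Z p] deriv_contact[of Y Z X p] deriv_contact[of Z X Y p]
      contact[of "bracket X Y" Z p] contact[of "bracket Y Z" X p] contact[of "bracket Z X" Y p] j
      b[of X Y "app \<eta> Z"] b[of Y Z "app \<eta> X"] b[of Z X "app \<eta> Y"]
    by simp
qed

text \<open>Replacing the derivatives in \<open>d\<^sup>2\<eta> = 0\<close> by covariant ones, the torsion-free terms cancel.\<close>

lemma cov_phi_cyclic:
  assumes [simp]: "smooth_vf A X" "smooth_vf A Y" "smooth_vf A Z"
  shows "cov_phi X Y Z p + cov_phi Y Z X p + cov_phi Z X Y p = 0"
proof -
  have m: "U p (\<lambda>q. g q (V q) (\<phi> q (W q))) =
      g p (D U V p) (\<phi> p (W p)) - g p (D U W p) (\<phi> p (V p)) + cov_phi U W V p"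
    if [simp]: "smooth_vf A U" "smooth_vf A V" "smooth_vf A W" for U V W
    using metric_D[of U V "app \<phi> W" p]
    by (simp add: cov_phi_def nabla_phi_def phi_skew[of "D U W p"] metric_sym[of "V p" p])
  show ?thesis
    using contact_form_closed[of X Y Z p] m[of X Y Z] m[of Y Z X] m[of Z X Y]
      cov_phi_skew[of X Z Y p] cov_phi_skew[of Y X Z p] cov_phi_skew[of Z Y X p]
    by (simp add: bracket_eq_D)
qed

text \<open>The alternation of \<open>D \<phi>\<close> in its first two arguments determines all of \<open>D \<phi>\<close>. The alternation is what the
  curvature condition controls.\<close>

lemma cov_phi_alternation:
  assumes [simp]: "smooth_vf A X" "smooth_vf A Y" "smooth_vf A Z"
  shows "g p (nabla_phi X Y p - nabla_phi Y X p) (Z p) = - cov_phi Z X Y p"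
  using cov_phi_cyclic[of X Y Z p] cov_phi_skew[of Y Z X p] by (simp add: cov_phi_def)

end

context contact_metric_connection
begin

lemma D_zero [simp]: "smooth_vf A X \<Longrightarrow> D X 0 = 0"
  using D_scaleR(2)[of X X 0] by simp

lemma app_eq_zero: "\<forall>q. \<eta> q (X q) = 0 \<Longrightarrow> app \<eta> X = (\<lambda>q. 0)"
  by (simp add: fun_eq_iff)

lemma nabla_phi_add [simp]:
  assumes [simp]: "smooth_vf A X" "smooth_vf A Y" "smooth_vf A Z"
  shows "nabla_phi (X + Y) Z = nabla_phi X Z + nabla_phi Y Z"
    "nabla_phi Z (X + Y) = nabla_phi Z X + nabla_phi Z Y"
proof -
  have "app \<phi> (X + Y) = app \<phi> X + app \<phi> Y" by (simp add: fun_eq_iff)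
  then show "nabla_phi (X + Y) Z = nabla_phi X Z + nabla_phi Y Z"
    "nabla_phi Z (X + Y) = nabla_phi Z X + nabla_phi Z Y"
    by (rule_tac ext; simp add: nabla_phi_def)+
qed

lemma nabla_phi_uminus:
  assumes [simp]: "smooth_vf A X" "smooth_vf A Y"
  shows "nabla_phi X (- Y) = - nabla_phi X Y"
proof -
  have "app \<phi> (- Y) = - app \<phi> Y" by (simp add: fun_eq_iff)
  then show ?thesis by (rule_tac ext) (simp add: nabla_phi_def)
qed

lemma cov_phi_add:
  assumes "smooth_vf A X" "smooth_vf A X'" "smooth_vf A Y" "smooth_vf A Z"
  shows "cov_phi (X + X') Y Z p = cov_phi X Y Z p + cov_phi X' Y Z p"
    "cov_phi Y (X + X') Z p = cov_phi Y X Z p + cov_phi Y X' Z p"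
    "cov_phi Y Z (X + X') p = cov_phi Y Z X p + cov_phi Y Z X' p"
  using assms by (simp_all add: cov_phi_def)

lemma cov_phi_uminus:
  assumes "smooth_vf A X" "smooth_vf A Y" "smooth_vf A Z"
  shows "cov_phi X (- Y) Z p = - cov_phi X Y Z p" "cov_phi X Y (- Z) p = - cov_phi X Y Z p"
  using assms by (simp_all add: cov_phi_def nabla_phi_uminus)

lemma phi_phi_horizontal:
  assumes "smooth_vf A X" "\<forall>q. \<eta> q (X q) = 0"
  shows "app \<phi> (app \<phi> X) = - X"
  using assms by (simp add: fun_eq_iff)

text \<open>The covariant derivative of \<open>\<phi>\<^sup>2 = - I\<close> on \<open>ker \<eta>\<close>.\<close>

lemma cov_phi_phi_shift:
  assumes [simp]: "smooth_vf A X" "smooth_vf A Y" "smooth_vf A Z"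
    and Y: "\<forall>q. \<eta> q (Y q) = 0" and Z: "\<forall>q. \<eta> q (Z q) = 0"
  shows "cov_phi X (app \<phi> Y) Z p = cov_phi X Y (app \<phi> Z) p"
  using Z by (simp add: cov_phi_def nabla_phi_def phi_phi_horizontal[OF _ Y] compatible_metric phi_skew)

text \<open>With \<open>D\<^sub>X \<xi> = - \<phi> X\<close>, the curvature \<open>R(X, Y)\<xi>\<close> is minus the alternation of \<open>D \<phi>\<close>. By \<open>cov_phi_alternation\<close> one
  obtains \<open>(D\<^sub>Z \<phi>) X = g(Z, X) \<xi> - \<eta>(X) Z\<close>, from which the Nijenhuis tensor is computed.\<close>

lemma sasakian_if_curvature:
  assumes h0: "\<And>p v. v \<in> TM p \<Longrightarrow> h p v = 0"
    and curv: "\<And>X Y p. smooth_vf A X \<Longrightarrow> smooth_vf A Y \<Longrightarrow>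
       curvature D X Y \<xi> p = \<eta> p (Y p) *\<^sub>R X p - \<eta> p (X p) *\<^sub>R Y p"
  shows "sasakian A \<phi> \<xi> \<eta>"
proof -
  have B: "D X \<xi> = - app \<phi> X" if "smooth_vf A X" for X
    using that by (rule_tac ext) (simp add: D_xi h0)
  have alt: "nabla_phi X Y p - nabla_phi Y X p = \<eta> p (X p) *\<^sub>R Y p - \<eta> p (Y p) *\<^sub>R X p"
    if [simp]: "smooth_vf A X" "smooth_vf A Y" for X Y p
    using curv[of X Y p] by (simp add: curvature_def B nabla_phi_def bracket_eq_D algebra_simps)
  have N: "nabla_phi Z X p = g p (Z p) (X p) *\<^sub>R \<xi> p - \<eta> p (X p) *\<^sub>R Z p"
    if [simp]: "smooth_vf A X" "smooth_vf A Z" for X Z p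
  proof (rule metric_eqI)
    fix v assume v: "v \<in> TM p"
    obtain Y where Y [simp]: "smooth_vf A Y" "Y p = v" using tangent_extension[OF v] .
    have "cov_phi Z X Y p = - g p (\<eta> p (X p) *\<^sub>R Y p - \<eta> p (Y p) *\<^sub>R X p) (Z p)"
      using cov_phi_alternation[of X Y Z p] by (simp add: alt)
    then show "g p v (nabla_phi Z X p) = g p v (g p (Z p) (X p) *\<^sub>R \<xi> p - \<eta> p (X p) *\<^sub>R Z p)"
      using v by (simp add: cov_phi_def metric_sym[of v p] metric_sym[of "X p" p "Z p"])
  qed simp_all
  show ?thesis
    unfolding sasakian_def
  proof (intro allI impI)
    fix X Y p assume [simp]: "smooth_vf A X" "smooth_vf A Y"
    have "nijenhuis \<phi> X Y p = nabla_phi (app \<phi> X) Y p - nabla_phi (app \<phi> Y) X p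
        + \<phi> p (nabla_phi Y X p) - \<phi> p (nabla_phi X Y p)"
      by (simp add: nijenhuis_def nabla_phi_def bracket_eq_D algebra_simps del: phi_phi)
    also have "\<dots> = (2 * g p (\<phi> p (X p)) (Y p)) *\<^sub>R \<xi> p"
      by (simp add: N phi_skew[of "Y p" p "X p"] metric_sym[of "Y p" p "\<phi> p (X p)"]
          scaleR_2[symmetric] algebra_simps)
    finally show "nijenhuis \<phi> X Y p + (2 * ext_deriv \<eta> X Y p) *\<^sub>R \<xi> p = 0"
      by (simp add: contact_metric phi_skew flip: scaleR_add_left)
  qed
qed

end

section \<open>The curvature condition and the square of h\<close>

locale kappa_mu_connection = contact_metric_connection A n \<phi> \<xi> \<eta> g D
  for A :: "('a::{t2_space, second_countable_topology}, 'e::euclidean_space) atlas"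
    and n :: nat and \<phi> :: "'a endo_field" and \<xi> :: "'a vector_field"
    and \<eta> :: "'a one_form" and g :: "'a bilinear_field"
    and D :: "'a vector_field \<Rightarrow> 'a vector_field \<Rightarrow> 'a vector_field" +
  fixes \<kappa> \<mu> :: real
  assumes curvature_xi: "smooth_vf A X \<Longrightarrow> smooth_vf A Y \<Longrightarrow> curvature D X Y \<xi> p =
        \<kappa> *\<^sub>R (\<eta> p (Y p) *\<^sub>R X p - \<eta> p (X p) *\<^sub>R Y p) +
        \<mu> *\<^sub>R (\<eta> p (Y p) *\<^sub>R h p (X p) - \<eta> p (X p) *\<^sub>R h p (Y p))"
begin

text \<open>The curvature condition for \<open>R(X, \<xi>)\<xi>\<close>, solved for the composition of \<open>\<phi>\<close> with the
  derivative of \<open>h\<close> along \<open>\<xi>\<close>.\<close>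

lemma phi_D_xi_h:
  assumes [simp]: "smooth_vf A X"
  shows "\<phi> p (D \<xi> (app h X) p - h p (D \<xi> X p)) =
    h p (h p (X p)) + \<mu> *\<^sub>R h p (X p) - (1 - \<kappa>) *\<^sub>R (X p - \<eta> p (X p) *\<^sub>R \<xi> p)"
  using curvature_xi[of X \<xi> p]
  by (simp add: curvature_def D_xi_field D_xi_phi bracket_eq_D algebra_simps)

text \<open>The derivative of \<open>h\<close> along \<open>\<xi>\<close> anticommutes with \<open>\<phi>\<close>, because \<open>h\<close> does and \<open>\<phi>\<close> is parallel along \<open>\<xi>\<close>. So the
  left-hand side of \<open>phi_D_xi_h\<close> anticommutes with \<open>\<phi>\<close>, and so does \<open>\<mu> h\<close>, while \<open>h\<^sup>2\<close> and \<open>(1 - \<kappa>) \<phi>\<^sup>2\<close>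
  commute with it. Hence the commuting part \<open>h\<^sup>2 + (1 - \<kappa>) \<phi>\<^sup>2\<close> vanishes.\<close>

lemma h_h:
  assumes v: "v \<in> TM p"
  shows "h p (h p v) = (1 - \<kappa>) *\<^sub>R (v - \<eta> p v *\<^sub>R \<xi> p)"
proof -
  obtain X where X [simp]: "smooth_vf A X" "X p = v" using tangent_extension[OF v] .
  define K where "K = D \<xi> (app h X) p - h p (D \<xi> X p)"
  have [simp]: "K \<in> TM p" by (simp add: K_def)
  have f: "app h (app \<phi> X) = - app \<phi> (app h X)" by (simp add: fun_eq_iff)
  have "D \<xi> (app h (app \<phi> X)) p - h p (D \<xi> (app \<phi> X) p) = - \<phi> p K"
    by (simp add: f K_def D_xi_phi)
  then have 1: "\<phi> p (- \<phi> p K) = h p (h p (\<phi> p v)) + \<mu> *\<^sub>R h p (\<phi> p v) - (1 - \<kappa>) *\<^sub>R \<phi> p v"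
    using phi_D_xi_h[of "app \<phi> X" p] v by (simp only: smooth_vf_phi X app_apply eta_phi) simp
  have "\<phi> p K = h p (h p v) + \<mu> *\<^sub>R h p v - (1 - \<kappa>) *\<^sub>R (v - \<eta> p v *\<^sub>R \<xi> p)"
    using phi_D_xi_h[of X p] by (simp add: K_def)
  then have 2: "\<phi> p (\<phi> p K) = \<phi> p (h p (h p v)) + \<mu> *\<^sub>R \<phi> p (h p v) - (1 - \<kappa>) *\<^sub>R \<phi> p v"
    using v by (simp del: phi_phi)
  \<comment> \<open>Fact 1 is \<open>phi_D_xi_h\<close> at \<open>\<phi> v\<close>, fact 2 is \<open>\<phi>\<close> applied to it at \<open>v\<close>; they equate \<open>x\<close> to one vector
    with opposite signs.\<close>
  define x where "x = \<phi> p (h p (h p v)) - (1 - \<kappa>) *\<^sub>R \<phi> p v"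
  have "x = \<mu> *\<^sub>R \<phi> p (h p v) - \<phi> p (\<phi> p K)"
    using 1 v by (simp del: phi_phi add: x_def algebra_simps)
  moreover have "x = \<phi> p (\<phi> p K) - \<mu> *\<^sub>R \<phi> p (h p v)"
    using 2 by (simp del: phi_phi add: x_def)
  ultimately have "x + x = 0" by simp
  then have "x = 0" using scaleR_half_double[of x] by simp
  then have "\<phi> p (h p (h p v) - (1 - \<kappa>) *\<^sub>R v) = 0" using v by (simp add: x_def)
  then have "\<phi> p (\<phi> p (h p (h p v) - (1 - \<kappa>) *\<^sub>R v)) = 0" by (simp del: phi_phi)
  then show ?thesis using v by (simp add: algebra_simps)
qed

text \<open>By symmetry of \<open>h\<close>, \<open>\<bar>h v\<bar>\<^sup>2 = g(h\<^sup>2 v, v) = (1 - \<kappa>) \<bar>\<phi> v\<bar>\<^sup>2\<close>, so \<open>\<kappa> \<ge> 1\<close> forces \<open>h = 0\<close>. It also forces \<open>\<kappa> = 1\<close>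
  unless \<open>ker \<eta> = 0\<close>; in both cases \<open>\<kappa>\<close> may be replaced by 1 in the curvature condition.\<close>

lemma kappa_less_1:
  assumes "\<not> sasakian A \<phi> \<xi> \<eta>"
  shows "\<kappa> < 1"
proof (rule ccontr)
  assume k: "\<not> \<kappa> < 1"
  have gh: "g p (h p v) (h p v) = (1 - \<kappa>) * g p (\<phi> p v) (\<phi> p v)" if v: "v \<in> TM p" for p v
    using h_sym[of v p "h p v"] v by (simp add: h_h compatible_metric algebra_simps)
  have h0: "h p v = 0" and p0: "(1 - \<kappa>) * g p (\<phi> p v) (\<phi> p v) = 0" if v: "v \<in> TM p" for p v
  proof -
    have "(1 - \<kappa>) * g p (\<phi> p v) (\<phi> p v) \<le> 0"
      using k metric_nonneg[of "\<phi> p v" p] v by (simp add: mult_nonpos_nonneg)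
    then have "g p (h p v) (h p v) = 0" using gh[OF v] metric_nonneg[of "h p v" p] v by simp
    then show "h p v = 0" "(1 - \<kappa>) * g p (\<phi> p v) (\<phi> p v) = 0"
      using metric_pos[of "h p v" p] gh[OF v] v by force+
  qed
  have f0: "(1 - \<kappa>) *\<^sub>R (v - \<eta> p v *\<^sub>R \<xi> p) = 0" if v: "v \<in> TM p" for p v
    using h_h[OF v] h0[OF v] by simp
  have "sasakian A \<phi> \<xi> \<eta>"
  proof (rule sasakian_if_curvature[OF h0])
    fix X Y p assume [simp]: "smooth_vf A X" "smooth_vf A Y"
    have "(1 - \<kappa>) *\<^sub>R (\<eta> p (Y p) *\<^sub>R X p - \<eta> p (X p) *\<^sub>R Y p) =
       \<eta> p (Y p) *\<^sub>R ((1 - \<kappa>) *\<^sub>R (X p - \<eta> p (X p) *\<^sub>R \<xi> p)) -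
       \<eta> p (X p) *\<^sub>R ((1 - \<kappa>) *\<^sub>R (Y p - \<eta> p (Y p) *\<^sub>R \<xi> p))"
      by (simp add: algebra_simps)
    also have "\<dots> = 0" by (simp add: f0 del: scaleR_eq_0_iff)
    finally show "curvature D X Y \<xi> p = \<eta> p (Y p) *\<^sub>R X p - \<eta> p (X p) *\<^sub>R Y p"
      by (simp add: curvature_xi h0 algebra_simps)
  qed
  then show False using assms by simp
qed

end

section \<open>The derivative of \<open>\<phi>\<close> on the contact distribution\<close>

locale non_sasakian_kappa_mu = kappa_mu_connection +
  assumes kappa: "\<kappa> < 1"
begin

definition lam :: real where "lam = sqrt (1 - \<kappa>)"

lemma lam_pos: "lam > 0" and lam_square: "lam * lam = 1 - \<kappa>"
  using kappa by (simp_all add: lam_def)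

text \<open>Eigenfields of \<open>S = h \<phi> = - \<phi> h\<close> in \<open>ker \<eta>\<close>. This operator is the symmetric part of \<open>X \<mapsto> D\<^sub>X \<xi>\<close>, so for such
  fields \<open>D\<^sub>X \<xi> = - \<phi> X + s X\<close>.\<close>

definition S_eigen :: "real \<Rightarrow> 'a vector_field \<Rightarrow> bool" where
  "S_eigen s X \<longleftrightarrow> smooth_vf A X \<and> (\<forall>q. \<eta> q (X q) = 0) \<and> (\<forall>q. \<phi> q (h q (X q)) = - s *\<^sub>R X q)"

lemma S_eigenD:
  assumes "S_eigen s X"
  shows "smooth_vf A X" "\<forall>q. \<eta> q (X q) = 0" "\<phi> q (h q (X q)) = - s *\<^sub>R X q"
  using assms unfolding S_eigen_def by auto

lemma S_eigen_phi:
  assumes "S_eigen s X"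
  shows "S_eigen (- s) (app \<phi> X)"
  using S_eigenD[OF assms] arg_cong[OF S_eigenD(3)[OF assms], where f = "\<phi> _"]
  unfolding S_eigen_def by (simp del: phi_phi)

text \<open>The equation \<open>R(X, Y)\<xi> = 0\<close>, paired with \<open>Z\<close>. Since \<open>S\<close> is symmetric and acts by constants on the three
  fields, \<open>g((D\<^sub>X S) Y, Z) = (t - u) g(D\<^sub>X Y, Z)\<close>.\<close>

lemma eigen_curvature:
  assumes X: "S_eigen s X" and Y: "S_eigen t Y" and Z: "S_eigen u Z"
  shows "(t - u) * g p (D X Y p) (Z p) - (s - u) * g p (D Y X p) (Z p) = - cov_phi Z X Y p"
proof -
  note [simp] = S_eigenD(1)[OF X] S_eigenD(1)[OF Y] S_eigenD(1)[OF Z]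
  have B: "D V \<xi> = - app \<phi> V + a *\<^sub>R V" if "S_eigen a V" for a V
    using S_eigenD[OF that] by (rule_tac ext) (simp add: D_xi)
  have S: "g p (\<phi> p (h p b)) (Z p) = - u * g p b (Z p)" if b: "b \<in> TM p" for b
  proof -
    have "g p (\<phi> p (h p b)) (Z p) = - g p b (h p (\<phi> p (Z p)))"
      using b by (simp add: phi_skew h_sym del: h_phi)
    then show ?thesis using b S_eigenD(3)[OF Z] by simp
  qed
  have "curvature D X Y \<xi> p = 0"
    using curvature_xi[of X Y p] S_eigenD(2)[OF X] S_eigenD(2)[OF Y] by simp
  then have "- (nabla_phi X Y p - nabla_phi Y X p) + t *\<^sub>R D X Y p - s *\<^sub>R D Y X p
       + \<phi> p (h p (bracket X Y p)) = 0"
    by (simp add: curvature_def B[OF X] B[OF Y] D_xi[of "D _ _"] D_xi[of "bracket _ _"]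
        nabla_phi_def bracket_eq_D algebra_simps)
  then have "g p (- (nabla_phi X Y p - nabla_phi Y X p) + t *\<^sub>R D X Y p - s *\<^sub>R D Y X p
       + \<phi> p (h p (bracket X Y p))) (Z p) = 0"
    by simp
  then have "t * g p (D X Y p) (Z p) - s * g p (D Y X p) (Z p) - u * g p (bracket X Y p) (Z p) =
      g p (nabla_phi X Y p - nabla_phi Y X p) (Z p)"
    by (simp add: S algebra_simps)
  then show ?thesis using cov_phi_alternation[of X Y Z p] by (simp add: bracket_eq_D algebra_simps)
qed

lemma cov_phi_eigen_same:
  assumes "S_eigen s X" "S_eigen s Y" "S_eigen s Z"
  shows "cov_phi X Y Z p = 0"
  using eigen_curvature[OF assms(2,3,1), of p] by simp

text \<open>Since \<open>\<phi>\<close> interchanges the eigendistributions of \<open>S\<close>, moving a \<open>\<phi>\<close> from the second to the third argument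
  reduces this to three fields with the same eigenvalue.\<close>

lemma cov_phi_eigen_opposite:
  assumes X: "S_eigen s X" and Y: "S_eigen (- s) Y" and Z: "S_eigen (- s) Z"
  shows "cov_phi X Y Z p = 0"
proof -
  note e = S_eigenD(1,2)[OF X] S_eigenD(1,2)[OF Y] S_eigenD(1,2)[OF Z]
  have Y': "S_eigen s (app \<phi> Y)" and Z': "S_eigen s (app \<phi> Z)"
    using S_eigen_phi[OF Y] S_eigen_phi[OF Z] by simp_all
  have "cov_phi X Y Z p = - cov_phi X (app \<phi> (app \<phi> Y)) Z p"
    using e by (simp add: phi_phi_horizontal cov_phi_uminus)
  also have "\<dots> = - cov_phi X (app \<phi> Y) (app \<phi> Z) p"
    using e cov_phi_phi_shift[of X "app \<phi> Y" Z p] by simp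
  also have "\<dots> = 0" using cov_phi_eigen_same[OF X Y' Z'] by simp
  finally show ?thesis .
qed

text \<open>For fixed sign, \<open>(U, V, W) \<mapsto> g((D\<^sub>U \<phi>) V, \<phi> W)\<close> is symmetric in \<open>U\<close>, \<open>V\<close> by the cyclic identity and the
  preceding case, and skew in \<open>V\<close>, \<open>W\<close>. A trilinear form with both properties is 0.\<close>

lemma cov_phi_eigen_mixed:
  assumes X: "S_eigen s X" and Y: "S_eigen s Y" and Z: "S_eigen (- s) Z"
  shows "cov_phi X Y Z p = 0"
proof -
  have sym: "cov_phi U V (app \<phi> W) p = cov_phi V U (app \<phi> W) p"
    if U: "S_eigen s U" and V: "S_eigen s V" and W: "S_eigen s W" for U V W
  proof -
    note e = S_eigenD(1)[OF U] S_eigenD(1)[OF V] S_eigenD(1)[OF W]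
    have "cov_phi (app \<phi> W) U V p = 0"
      using cov_phi_eigen_opposite[OF S_eigen_phi[OF W]] U V by simp
    then show ?thesis
      using e cov_phi_cyclic[of U V "app \<phi> W" p] cov_phi_skew[of V "app \<phi> W" U p] by simp
  qed
  have skew: "cov_phi U V (app \<phi> W) p = - cov_phi U W (app \<phi> V) p"
    if U: "S_eigen s U" and V: "S_eigen s V" and W: "S_eigen s W" for U V W
  proof -
    note e = S_eigenD(1,2)[OF U] S_eigenD(1,2)[OF V] S_eigenD(1,2)[OF W]
    show ?thesis using e cov_phi_phi_shift[of U V W p] cov_phi_skew[of U "app \<phi> V" W p] by simp
  qed
  define W where "W = app \<phi> Z"
  have W: "S_eigen s W" using S_eigen_phi[OF Z] by (simp add: W_def)
  have "cov_phi X Y (app \<phi> W) p = 0"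
    using sym[OF X Y W] sym[OF Y W X] sym[OF W X Y] skew[OF X Y W] skew[OF Y W X] skew[OF W X Y]
    by simp
  then show ?thesis
    using S_eigenD(1,2)[OF X] S_eigenD(1,2)[OF Y] S_eigenD(1,2)[OF Z]
    by (simp add: W_def phi_phi_horizontal cov_phi_uminus)
qed

lemma cov_phi_eigen:
  assumes X: "S_eigen s X" and Y: "S_eigen t Y" and Z: "S_eigen u Z"
    and "s \<in> {lam, - lam}" "t \<in> {lam, - lam}" "u \<in> {lam, - lam}"
  shows "cov_phi X Y Z p = 0"
proof -
  consider "t = s" "u = s" | "t = - s" "u = - s" | "t = s" "u = - s" | "t = - s" "u = s"
    using assms(4-6) by auto
  then show ?thesis
  proof cases
    case 1
    then show ?thesis using cov_phi_eigen_same X Y Z by blast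
  next
    case 2
    then show ?thesis using cov_phi_eigen_opposite X Y Z by blast
  next
    case 3
    then show ?thesis using cov_phi_eigen_mixed X Y Z by blast
  next
    case 4
    then show ?thesis
      using cov_phi_eigen_mixed[OF X, of Z Y p] Y Z cov_phi_skew[of X Y Z p] S_eigenD(1) X by simp
  qed
qed

lemma S_eigen_decomposition:
  assumes [simp]: "smooth_vf A X" and X: "\<forall>q. \<eta> q (X q) = 0"
  obtains X1 X2 where "S_eigen lam X1" "S_eigen (- lam) X2" "X = X1 + X2"
proof
  have l0: "lam \<noteq> 0" using lam_pos by simp
  have hh: "h q (h q (X q)) = (lam * lam) *\<^sub>R X q" for q
    using h_h[of "X q" q] X by (simp add: lam_square)
  show "S_eigen lam ((1/2) *\<^sub>R X - (1 / (2 * lam)) *\<^sub>R app \<phi> (app h X))"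
    "S_eigen (- lam) ((1/2) *\<^sub>R X + (1 / (2 * lam)) *\<^sub>R app \<phi> (app h X))"
    unfolding S_eigen_def using X l0 by (simp_all add: hh algebra_simps)
  have half: "(a - s) + (a + s) = a + a" for a s :: "'a vector_field"
    by (simp add: algebra_simps)
  show "X = ((1/2) *\<^sub>R X - (1 / (2 * lam)) *\<^sub>R app \<phi> (app h X)) +
      ((1/2) *\<^sub>R X + (1 / (2 * lam)) *\<^sub>R app \<phi> (app h X))"
    unfolding half by (rule scaleR_half_double[of X, unfolded scaleR_add_right, symmetric])
qed

lemma cov_phi_horizontal:
  assumes X: "smooth_vf A X" "\<forall>q. \<eta> q (X q) = 0" and Y: "smooth_vf A Y" "\<forall>q. \<eta> q (Y q) = 0"
    and Z: "smooth_vf A Z" "\<forall>q. \<eta> q (Z q) = 0"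
  shows "cov_phi X Y Z p = 0"
proof -
  obtain X1 X2 where x: "S_eigen lam X1" "S_eigen (- lam) X2" "X = X1 + X2"
    using S_eigen_decomposition[OF X] .
  obtain Y1 Y2 where y: "S_eigen lam Y1" "S_eigen (- lam) Y2" "Y = Y1 + Y2"
    using S_eigen_decomposition[OF Y] .
  obtain Z1 Z2 where z: "S_eigen lam Z1" "S_eigen (- lam) Z2" "Z = Z1 + Z2"
    using S_eigen_decomposition[OF Z] .
  note sm [simp] = S_eigenD(1)[OF x(1)] S_eigenD(1)[OF x(2)] S_eigenD(1)[OF y(1)]
    S_eigenD(1)[OF y(2)] S_eigenD(1)[OF z(1)] S_eigenD(1)[OF z(2)]
  have e: "cov_phi U V W p = 0" if "U \<in> {X1, X2}" "V \<in> {Y1, Y2}" "W \<in> {Z1, Z2}" for U V W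
    using that x y z cov_phi_eigen[of lam U] cov_phi_eigen[of "- lam" U] by fast
  show ?thesis unfolding x(3) y(3) z(3) by (simp add: cov_phi_add e)
qed

text \<open>By \<open>cov_phi_alternation\<close>, the components of the difference in \<open>ker \<eta>\<close> vanish by \<open>cov_phi_horizontal\<close>, and
  the one along \<open>\<xi>\<close> because \<open>\<phi>\<close> is parallel along \<open>\<xi>\<close>.\<close>

lemma nabla_phi_horizontal:
  assumes [simp]: "smooth_vf A X" "smooth_vf A Y"
    and X: "\<forall>q. \<eta> q (X q) = 0" and Y: "\<forall>q. \<eta> q (Y q) = 0"
  shows "nabla_phi X Y p = nabla_phi Y X p"
proof -
  have "nabla_phi X Y p - nabla_phi Y X p = 0"
  proof (rule metric_eqI)
    fix v assume v: "v \<in> TM p"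
    obtain Z where Z [simp]: "smooth_vf A Z" "Z p = v" using tangent_extension[OF v] .
    have xi: "nabla_phi (\<lambda>p. f p *\<^sub>R \<xi> p) X = 0" if "smooth_fun A f" for f
      using that by (rule_tac ext) (simp add: nabla_phi_def D_scaleR_fun D_xi_phi)
    have "Z = - app \<phi> (app \<phi> Z) + (\<lambda>p. app \<eta> Z p *\<^sub>R \<xi> p)"
      by (simp add: phi_phi_field del: app_apply)
    then have "cov_phi Z X Y p = cov_phi (- app \<phi> (app \<phi> Z) + (\<lambda>p. app \<eta> Z p *\<^sub>R \<xi> p)) X Y p"
      by simp
    also have "\<dots> = cov_phi (- app \<phi> (app \<phi> Z)) X Y p + cov_phi (\<lambda>p. app \<eta> Z p *\<^sub>R \<xi> p) X Y p"
      by (rule cov_phi_add) (use smooth_vf_scaleR_fun[OF smooth_fun_eta[OF Z(1)] xi_smooth] in simp_all)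
    also have "cov_phi (- app \<phi> (app \<phi> Z)) X Y p = 0"
      using X Y by (intro cov_phi_horizontal) (simp_all del: phi_phi)
    also have "cov_phi (\<lambda>p. app \<eta> Z p *\<^sub>R \<xi> p) X Y p = 0"
      unfolding cov_phi_def xi[OF smooth_fun_eta[OF Z(1)]] by simp
    finally have "cov_phi Z X Y p = 0" by simp
    then show "g p v (nabla_phi X Y p - nabla_phi Y X p) = g p v 0"
      using cov_phi_alternation[of X Y Z p] v metric_sym[of v p "nabla_phi X Y p - nabla_phi Y X p"] by simp
  qed simp_all
  then show ?thesis by simp
qed

section \<open>Involutivity of the eigendistributions\<close>

lemma curvature_horizontal:
  assumes [simp]: "smooth_vf A X" "smooth_vf A Y"
    and X: "\<forall>q. \<eta> q (X q) = 0" and Y: "\<forall>q. \<eta> q (Y q) = 0"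
  shows "D X (D Y \<xi>) p - D Y (D X \<xi>) p = - \<phi> p (bracket X Y p) - \<phi> p (h p (bracket X Y p))"
  using curvature_xi[of X Y p] X Y by (simp add: curvature_def D_xi[of "bracket X Y"])

lemma D_phi_horizontal:
  assumes [simp]: "smooth_vf A X" "smooth_vf A Y"
    and X: "\<forall>q. \<eta> q (X q) = 0" and Y: "\<forall>q. \<eta> q (Y q) = 0"
  shows "D X (app \<phi> Y) p - D Y (app \<phi> X) p = \<phi> p (bracket X Y p)"
  using nabla_phi_horizontal[OF assms] by (simp add: nabla_phi_def bracket_eq_D algebra_simps)

text \<open>On the eigendistribution \<open>D\<^sub>X \<xi> = - (1 + c) \<phi> X\<close>, so \<open>curvature_horizontal\<close> becomes
  \<open>(1 + c) \<phi>[X, Y] = \<phi>[X, Y] + \<phi> h[X, Y]\<close>, that is, \<open>\<phi> (h[X, Y] - c [X, Y]) = 0\<close>. The kernel of \<open>\<phi>\<close> is spanned by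
  \<open>\<xi>\<close>; that \<open>[X, Y]\<close> lies in \<open>ker \<eta>\<close> follows from \<open>g(X, \<phi> Y) = 0\<close>, as \<open>\<phi> Y\<close> belongs to the eigenvalue \<open>- c\<close>.\<close>

lemma involutive_h:
  assumes c: "c \<noteq> 0"
  shows "involutive A (eigendistribution A h c)"
  unfolding involutive_def
proof (intro allI impI)
  fix X Y p
  assume sm [simp]: "smooth_vf A X" "smooth_vf A Y"
    and X: "\<forall>p. X p \<in> eigendistribution A h c p" and Y: "\<forall>p. Y p \<in> eigendistribution A h c p"
  have eta: "\<eta> q v = 0" if "h q v = c *\<^sub>R v" "v \<in> TM q" for v q
    using eta_h[OF that(2)] that c by simp
  have hX: "h q (X q) = c *\<^sub>R X q" and hY: "h q (Y q) = c *\<^sub>R Y q" for q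
    using X Y unfolding eigendistribution_def by auto
  have eX: "\<forall>q. \<eta> q (X q) = 0" and eY: "\<forall>q. \<eta> q (Y q) = 0" using eta hX hY by simp_all
  let ?b = "bracket X Y p"
  have "c * g p (X p) (\<phi> p (Y p)) = - c * g p (X p) (\<phi> p (Y p))"
    using h_sym[of "X p" p "\<phi> p (Y p)"] by (simp add: hX hY)
  then have "g p (X p) (\<phi> p (Y p)) = 0" using c by simp
  then have eb: "\<eta> p ?b = 0"
    using contact[of X Y p] app_eq_zero[OF eX] app_eq_zero[OF eY]
    by (simp add: tangent_const[of _ p])
  have B: "D V \<xi> = (- (1 + c)) *\<^sub>R app \<phi> V" if "smooth_vf A V" "\<And>q. h q (V q) = c *\<^sub>R V q" for V
    using that by (rule_tac ext) (simp add: D_xi algebra_simps)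
  have "\<phi> p (h p ?b) = \<phi> p (c *\<^sub>R ?b)"
    using curvature_horizontal[OF sm eX eY, of p] D_phi_horizontal[OF sm eX eY, of p]
    by (simp add: B hX hY algebra_simps flip: scaleR_diff_right)
  then have "\<phi> p (\<phi> p (h p ?b)) = \<phi> p (\<phi> p (c *\<^sub>R ?b))" by (simp only:)
  then have "h p ?b = c *\<^sub>R ?b" by (simp add: eb)
  then show "?b \<in> eigendistribution A h c p" unfolding eigendistribution_def by simp
qed

text \<open>Here \<open>D\<^sub>X \<xi> = - \<phi> X - c X\<close>, and \<open>curvature_horizontal\<close> reads \<open>\<phi> h[X, Y] = c [X, Y]\<close> directly.\<close>

lemma involutive_phi_h:
  assumes c: "c \<noteq> 0"
  shows "involutive A (eigendistribution A (comp_endo \<phi> h) c)"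
  unfolding involutive_def
proof (intro allI impI)
  fix X Y p
  assume sm [simp]: "smooth_vf A X" "smooth_vf A Y"
    and X: "\<forall>p. X p \<in> eigendistribution A (comp_endo \<phi> h) c p"
    and Y: "\<forall>p. Y p \<in> eigendistribution A (comp_endo \<phi> h) c p"
  have eta: "\<eta> q v = 0" if "\<phi> q (h q v) = c *\<^sub>R v" "v \<in> TM q" for v q
    using eta_phi[of "h q v" q] that c by simp
  have hX: "\<phi> q (h q (X q)) = c *\<^sub>R X q" and hY: "\<phi> q (h q (Y q)) = c *\<^sub>R Y q" for q
    using X Y unfolding eigendistribution_def comp_endo_def by auto
  have eX: "\<forall>q. \<eta> q (X q) = 0" and eY: "\<forall>q. \<eta> q (Y q) = 0" using eta hX hY by simp_all
  let ?b = "bracket X Y p"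
  have B: "D V \<xi> = - app \<phi> V - c *\<^sub>R V" if "smooth_vf A V" "\<And>q. \<phi> q (h q (V q)) = c *\<^sub>R V q" for V
    using that by (rule_tac ext) (simp add: D_xi)
  have b: "?b = D X Y p - D Y X p" by (simp add: bracket_eq_D)
  have "D X (D Y \<xi>) p - D Y (D X \<xi>) p =
      - (D X (app \<phi> Y) p - D Y (app \<phi> X) p) - c *\<^sub>R (D X Y p - D Y X p)"
    by (simp add: B hX hY algebra_simps)
  then have "\<phi> p (h p ?b) = c *\<^sub>R ?b"
    using curvature_horizontal[OF sm eX eY, of p] D_phi_horizontal[OF sm eX eY, of p]
    unfolding b[symmetric] by simp
  then show "?b \<in> eigendistribution A (comp_endo \<phi> h) c p"
    unfolding eigendistribution_def comp_endo_def by simp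
qed

end

section \<open>Rank of the eigendistributions\<close>

lemma independent_Un_if_span_Int:
  fixes B C :: "'b::real_vector set"
  assumes B: "independent B" and C: "independent C" and BC: "span B \<inter> span C \<subseteq> {0}"
  shows "independent (B \<union> C)" "B \<inter> C = {}"
proof -
  have "x = 0" if "x \<in> B" "x \<in> C" for x using that BC span_base by blast
  then show disj: "B \<inter> C = {}" using B dependent_zero by blast
  show "independent (B \<union> C)"
    unfolding independent_explicit_module
  proof (intro allI impI)
    fix S u v
    assume S: "finite S" "S \<subseteq> B \<union> C" "(\<Sum>v\<in>S. u v *\<^sub>R v) = 0" "v \<in> S"
    define b where "b = (\<Sum>v\<in>S \<inter> B. u v *\<^sub>R v)"
    define c where "c = (\<Sum>v\<in>S \<inter> C. u v *\<^sub>R v)"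
    have "S = (S \<inter> B) \<union> (S \<inter> C)" using S(2) by blast
    then have "(\<Sum>v\<in>S. u v *\<^sub>R v) = b + c"
      unfolding b_def c_def using sum.union_disjoint[of "S \<inter> B" "S \<inter> C" "\<lambda>v. u v *\<^sub>R v"] disj S(1)
      by (metis Int_assoc finite_Int inf_bot_right inf_left_commute)
    then have bc: "b = - c" using S(3) by (simp add: add_eq_0_iff)
    have "b \<in> span B" "c \<in> span C"
      unfolding b_def c_def by (rule span_sum, rule span_scale, rule span_base, blast)+
    then have "b \<in> span B \<inter> span C" using bc span_neg by blast
    then have "b = 0" "c = 0" using BC bc by auto
    then show "u v = 0"
      using independentD[OF B, of "S \<inter> B" u v] independentD[OF C, of "S \<inter> C" u v] S
      unfolding b_def c_def by blast
  qed
qed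

lemma span_eq_if_card_eq:
  fixes B C :: "'b::real_vector set"
  assumes B: "finite B" and C: "independent C" "C \<subseteq> span B" "finite C" "card C = card B"
  shows "span C = span B"
proof
  show "span C \<subseteq> span B" using C(2) span_minimal subspace_span by blast
  have "v \<in> span C" if v: "v \<in> span B" for v
  proof (rule ccontr)
    assume n: "v \<notin> span C"
    then have "independent (insert v C)" using C(1) independent_insertI by blast
    moreover have "v \<notin> C" using n span_base by blast
    ultimately show False
      using independent_span_bound[OF B, of "insert v C"] v C by simp
  qed
  then show "span B \<subseteq> span C" by blast
qed

text \<open>The matrix \<open>x i (f j)\<close> is strictly diagonally dominant: in a vanishing combination of the \<open>x i\<close>, the entry
  \<open>j\<close> with the largest coefficient cannot be balanced by the others. The condition is open in \<open>x\<close>, which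
  makes it suitable for fields that are independent at one point.\<close>

lemma near_dual_family_independent:
  fixes x :: "nat \<Rightarrow> ('b \<Rightarrow> real)"
  assumes m: "\<And>i j. i < n \<Longrightarrow> j < n \<Longrightarrow> \<bar>x i (f j) - (if i = j then 1 else 0)\<bar> < 1 / (real n + 1)"
  shows "inj_on x {..<n}" "independent (x ` {..<n})"
proof -
  have zero: "c i = 0" if c: "(\<Sum>i<n. c i *\<^sub>R x i) = 0" and i: "i < n" for c i
  proof (rule ccontr)
    assume "c i \<noteq> 0"
    let ?I = "(\<lambda>i. \<bar>c i\<bar>) ` {..<n}"
    have "Max ?I \<in> ?I" using i by (intro Max_in) auto
    then obtain j where j0: "j < n" "Max ?I = \<bar>c j\<bar>" by auto
    have "\<bar>c k\<bar> \<le> Max ?I" if "k < n" for k using that by (intro Max_ge) auto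
    then have j: "j < n" "\<And>k. k < n \<Longrightarrow> \<bar>c k\<bar> \<le> \<bar>c j\<bar>"
      by (simp_all only: j0)
    have cj: "\<bar>c j\<bar> > 0" using j(2)[OF i] \<open>c i \<noteq> 0\<close> by linarith
    have "(\<Sum>k<n. c k *\<^sub>R x k) (f j) = (\<Sum>k<n. c k * x k (f j))"
      by (induction n) simp_all
    then have "0 = (\<Sum>k<n. c k * x k (f j))" using c by simp
    also have "\<dots> = (\<Sum>k<n. c k * (x k (f j) - (if k = j then 1 else 0)) + c k * (if k = j then 1 else 0))"
      by (intro sum.cong) (simp_all add: algebra_simps)
    also have "\<dots> = (\<Sum>k<n. c k * (x k (f j) - (if k = j then 1 else 0))) + c j"
      using j(1) by (simp add: sum.distrib if_distrib[of "(*) _"] cong: if_cong)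
    finally have "c j = - (\<Sum>k<n. c k * (x k (f j) - (if k = j then 1 else 0)))" by simp
    then have "\<bar>c j\<bar> \<le> (\<Sum>k<n. \<bar>c k * (x k (f j) - (if k = j then 1 else 0))\<bar>)"
      using sum_abs[of "\<lambda>k. c k * (x k (f j) - (if k = j then 1 else 0))" "{..<n}"] by linarith
    also have "\<dots> \<le> (\<Sum>k<n. \<bar>c j\<bar> * (1 / (real n + 1)))"
    proof (rule sum_mono)
      fix k assume "k \<in> {..<n}"
      then show "\<bar>c k * (x k (f j) - (if k = j then 1 else 0))\<bar> \<le> \<bar>c j\<bar> * (1 / (real n + 1))"
        unfolding abs_mult using j(2)[of k] less_imp_le[OF m[of k j]] j(1)
        by (intro mult_mono) auto
    qed
    also have "\<dots> = \<bar>c j\<bar> * (real n / (real n + 1))" by simp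
    also have "\<dots> < \<bar>c j\<bar> * 1" using cj by (intro mult_strict_left_mono) (auto simp: field_simps)
    finally show False by simp
  qed
  show inj: "inj_on x {..<n}"
  proof (rule inj_onI, rule ccontr)
    fix i j assume ij: "i \<in> {..<n}" "j \<in> {..<n}" "x i = x j" "i \<noteq> j"
    let ?c = "\<lambda>k. if k = i then 1 else if k = j then -1 else (0::real)"
    have "(\<Sum>k<n. ?c k *\<^sub>R x k) = (\<Sum>k\<in>{i, j}. ?c k *\<^sub>R x k)"
      by (rule sum.mono_neutral_right) (use ij in auto)
    also have "\<dots> = 0" using ij by simp
    finally show False using zero[of ?c i] ij by simp
  qed
  show "independent (x ` {..<n})"
  proof (rule independent_if_scalars_zero)
    fix u v assume u: "(\<Sum>v\<in>x ` {..<n}. u v *\<^sub>R v) = 0" and v: "v \<in> x ` {..<n}"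
    have "(\<Sum>i<n. (u \<circ> x) i *\<^sub>R x i) = 0" using u by (simp add: sum.reindex[OF inj])
    then show "u v = 0" using zero[of "u \<circ> x"] v by auto
  qed simp
qed

context contact_metric_connection
begin

text \<open>The value \<open>\<phi> p\<close> is linear only on the tangent space, while general results about linear maps concern maps
  on the whole space of functionals.\<close>

lemma linear_extension_of_phi:
  obtains f where "linear f" "\<And>v. v \<in> TM p \<Longrightarrow> f v = \<phi> p v"
proof -
  obtain B where B: "independent B" "span B = TM p" using tangent_space_basis[of p] by blast
  obtain f where f: "linear f" "\<forall>b\<in>B. f b = \<phi> p b" using linear_independent_extend[OF B(1)] by blast
  have "subspace {v \<in> TM p. f v = \<phi> p v}"
    by (rule subspaceI) (simp_all add: linear_0[OF f(1)] linear_add[OF f(1)] linear_cmul[OF f(1)])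
  moreover have "B \<subseteq> {v \<in> TM p. f v = \<phi> p v}" using f(2) B(2) span_base by blast
  ultimately have "span B \<subseteq> {v \<in> TM p. f v = \<phi> p v}" by (rule span_minimal[rotated])
  then show ?thesis using that f(1) B(2) by blast
qed

end

text \<open>The properties common to \<open>\<phi> h / \<lambda>\<close> and \<open>h / \<lambda>\<close> that determine the rank of their eigendistributions; \<open>c\<close>
  selects one of the two.\<close>

locale paracontact_endo = contact_metric_connection +
  fixes Q :: "'a endo_field" and c :: real
  assumes Q_smooth: "smooth_endo A Q"
    and Q_Q: "v \<in> tangent_space A p \<Longrightarrow> Q p (Q p v) = v - \<eta> p v *\<^sub>R \<xi> p"
    and Q_xi: "Q p (\<xi> p) = 0"
    and Q_phi: "v \<in> tangent_space A p \<Longrightarrow> Q p (\<phi> p v) = - \<phi> p (Q p v)"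
    and c: "c \<in> {1, -1}"
begin

lemma Q_tangent [simp]: "v \<in> TM p \<Longrightarrow> Q p v \<in> TM p"
  using Q_smooth unfolding smooth_endo_def by blast

lemma Q_comb:
  "v \<in> TM p \<Longrightarrow> w \<in> TM p \<Longrightarrow> Q p (a *\<^sub>R v + b *\<^sub>R w) = a *\<^sub>R Q p v + b *\<^sub>R Q p w"
  using Q_smooth unfolding smooth_endo_def by blast

lemma Q_linear [simp]:
  "v \<in> TM p \<Longrightarrow> w \<in> TM p \<Longrightarrow> Q p (v + w) = Q p v + Q p w"
  "v \<in> TM p \<Longrightarrow> w \<in> TM p \<Longrightarrow> Q p (v - w) = Q p v - Q p w"
  "v \<in> TM p \<Longrightarrow> Q p (- v) = - Q p v"
  "v \<in> TM p \<Longrightarrow> Q p (a *\<^sub>R v) = a *\<^sub>R Q p v"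
  "Q p 0 = 0"
  using Q_comb[of v p w 1 1] Q_comb[of v p w 1 "-1"] Q_comb[of v p v "-1" 0]
    Q_comb[of v p v a 0] Q_comb[of 0 p 0 0 0] by simp_all

abbreviation E :: "real \<Rightarrow> 'a distribution" where "E \<equiv> eigendistribution A Q"

lemma E_iff: "v \<in> E a p \<longleftrightarrow> v \<in> TM p \<and> Q p v = a *\<^sub>R v"
  by (auto simp: eigendistribution_def)

lemma subspace_E: "subspace (E a p)"
  by (rule subspaceI) (auto simp: E_iff algebra_simps)

lemma xi_nonzero: "\<xi> p \<noteq> 0"
proof
  assume "\<xi> p = 0"
  then show False using eta_xi[of p] by (simp del: eta_xi)
qed

lemma c_c [simp]: "c * c = 1" and c_nonzero: "c \<noteq> 0"
  using c by auto

lemma eta_E: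
  assumes "v \<in> E c p \<or> v \<in> E (- c) p"
  shows "\<eta> p v = 0"
proof -
  have "Q p (Q p v) = v" "v \<in> TM p" using assms by (auto simp: E_iff)
  then have "\<eta> p v *\<^sub>R \<xi> p = 0" using Q_Q[of v p] by simp
  then show ?thesis using xi_nonzero by simp
qed

text \<open>Since \<open>Q\<^sup>3 = Q\<close>, the operators \<open>(Q\<^sup>2 + c Q) / 2\<close> and \<open>(Q\<^sup>2 - c Q) / 2\<close> are the projections onto the two
  eigenspaces. Being polynomials in \<open>Q\<close>, they preserve smoothness of fields.\<close>

lemma E_projection:
  assumes "v \<in> TM p"
  shows "(1/2) *\<^sub>R (Q p (Q p v) + c *\<^sub>R Q p v) \<in> E c p"
    "(1/2) *\<^sub>R (Q p (Q p v) - c *\<^sub>R Q p v) \<in> E (- c) p"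
proof -
  have "Q p (Q p (Q p v)) = Q p v" using assms by (simp add: Q_Q Q_xi)
  then show "(1/2) *\<^sub>R (Q p (Q p v) + c *\<^sub>R Q p v) \<in> E c p"
    "(1/2) *\<^sub>R (Q p (Q p v) - c *\<^sub>R Q p v) \<in> E (- c) p"
    using assms by (simp_all add: E_iff scaleR_add_right scaleR_diff_right)
qed

lemma phi_E:
  assumes "v \<in> E a p" shows "\<phi> p v \<in> E (- a) p"
  using assms by (simp add: E_iff Q_phi)

text \<open>If \<open>B\<close> is a basis of one eigenspace, then \<open>\<phi> B\<close> is one of the other, and \<open>B \<union> \<phi> B \<union> {\<xi>}\<close> is a basis of the
  tangent space. Counting gives \<open>2 \<bar>B\<bar> + 1 = 2 n + 1\<close>.\<close>

lemma E_basis: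
  obtains B where "finite B" "independent B" "span B = E c p" "card B = n"
proof -
  obtain Bt where Bt: "finite Bt" "independent Bt" "card Bt = 2 * n + 1" "span Bt = TM p"
    using tangent_space_basis[of p] dimension by metis
  obtain B where B: "B \<subseteq> E c p" "independent B" "E c p \<subseteq> span B"
    using maximal_independent_subset[of "E c p"] by blast
  have sB: "span B = E c p" using B span_minimal[OF B(1) subspace_E] by blast
  have "B \<subseteq> span Bt" using B(1) Bt(4) by (auto simp: E_iff)
  then have fB: "finite B" using independent_span_bound[OF Bt(1) B(2)] by blast
  obtain f where f: "linear f" "\<And>v. v \<in> TM p \<Longrightarrow> f v = \<phi> p v" by (rule linear_extension_of_phi) (rule that)
  have ff: "f (f v) = - v" if "v \<in> E c p \<or> v \<in> E (- c) p" for v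
    using eta_E[OF that] that f(2) by (auto simp: E_iff)
  have inj: "inj_on f (span B)"
    unfolding sB by (rule inj_onI) (metis ff neg_equal_iff_equal)
  let ?C = "f ` B"
  have C: "independent ?C" using linear_independent_injective_image[OF f(1) B(2) inj] .
  have cC: "card ?C = card B" using card_image inj_on_subset[OF inj span_superset] by blast
  have sC: "span ?C = E (- c) p"
  proof
    have "f v \<in> E (- c) p" if "v \<in> E c p" for v using phi_E[OF that] f(2) that by (simp add: E_iff)
    then show "span ?C \<subseteq> E (- c) p" using B(1) by (intro span_minimal subspace_E) auto
    show "E (- c) p \<subseteq> span ?C"
    proof
      fix v assume v: "v \<in> E (- c) p"
      have "- f v \<in> E c p" using phi_E[OF v] f(2) v by (simp add: E_iff)
      moreover have "v = f (- f v)" using ff v by (simp add: linear_neg[OF f(1)])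
      ultimately show "v \<in> span ?C" unfolding linear_span_image[OF f(1)] sB by blast
    qed
  qed
  have BC: "span B \<inter> span ?C \<subseteq> {0}"
  proof
    fix v assume "v \<in> span B \<inter> span ?C"
    then have v: "v \<in> E c p" "v \<in> E (- c) p" unfolding sB sC by simp_all
    have "Q p v = c *\<^sub>R v" using v(1) by (simp add: E_iff)
    moreover have "Q p v = - (c *\<^sub>R v)" using v(2) by (simp add: E_iff)
    ultimately have "c *\<^sub>R v + c *\<^sub>R v = 0" by (metis ab_left_minus)
    then have "c *\<^sub>R v = 0" using scaleR_half_double[of "c *\<^sub>R v"] by simp
    then show "v \<in> {0}" using c_nonzero by simp
  qed
  note ind = independent_Un_if_span_Int[OF B(2) C BC]
  have eta0: "\<eta> p v = 0" "v \<in> TM p" if v: "v \<in> span (B \<union> ?C)" for v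
  proof -
    obtain x y where "v = x + y" "x \<in> E c p" "y \<in> E (- c) p"
      using v unfolding span_Un sB sC by blast
    then show "\<eta> p v = 0" "v \<in> TM p" using eta_E[of x p] eta_E[of y p] by (simp_all add: E_iff)
  qed
  have xi: "\<xi> p \<notin> span (B \<union> ?C)" using eta0[of "\<xi> p"] eta_xi[of p] by force
  let ?U = "insert (\<xi> p) (B \<union> ?C)"
  have U: "independent ?U" using independent_insertI[OF xi ind(1)] .
  have "\<xi> p \<notin> B \<union> ?C" by (rule contra_subsetD[OF span_superset xi])
  then have cU: "card ?U = 2 * card B + 1"
    using card_insert_disjoint[of "B \<union> ?C" "\<xi> p"] card_Un_disjoint[OF fB _ ind(2)] fB cC by simp
  have "?U \<subseteq> span Bt" unfolding Bt(4) using eta0(2) span_base[of _ "B \<union> ?C"] by auto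
  then have 1: "2 * card B + 1 \<le> 2 * n + 1"
    using independent_span_bound[OF Bt(1) U] cU Bt(3) by simp
  have "Bt \<subseteq> span ?U"
  proof
    fix v assume "v \<in> Bt"
    then have v: "v \<in> TM p" using Bt(4) span_base by blast
    let ?x = "(1/2) *\<^sub>R (Q p (Q p v) + c *\<^sub>R Q p v)" and ?y = "(1/2) *\<^sub>R (Q p (Q p v) - c *\<^sub>R Q p v)"
    have "?x \<in> span ?U" "?y \<in> span ?U"
      using E_projection[OF v] span_mono[of B ?U] span_mono[of ?C ?U] unfolding sB[symmetric] sC[symmetric]
      by auto
    moreover have "\<eta> p v *\<^sub>R \<xi> p \<in> span ?U" by (intro span_scale span_base) simp
    moreover have "v = (?x + ?y) + \<eta> p v *\<^sub>R \<xi> p"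
    proof -
      have "?x + ?y = (1/2) *\<^sub>R (Q p (Q p v) + Q p (Q p v))"
        unfolding scaleR_add_right[symmetric] by (rule arg_cong[of _ _ "(*\<^sub>R) (1/2)"]) simp
      also have "\<dots> = Q p (Q p v)" by (rule scaleR_half_double)
      finally show ?thesis using Q_Q[OF v] by simp
    qed
    ultimately show "v \<in> span ?U" by (metis span_add)
  qed
  then have "2 * n + 1 \<le> 2 * card B + 1"
    using independent_span_bound[OF _ Bt(2), of ?U] fB cU Bt(3) by simp
  then show ?thesis using that[OF fB B(2) sB] 1 by simp
qed

text \<open>A basis of the eigenspace at \<open>p\<close> is extended to smooth fields and projected to the eigendistribution.
  Functions whose differentials at \<open>p\<close> are dual to the basis show that the fields remain independent
  nearby, and they span because all eigenspaces have dimension \<open>n\<close>.\<close>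

lemma subbundle_E: "subbundle A n (E c)"
  unfolding subbundle_def
proof
  fix p
  obtain B where B: "finite B" "independent B" "span B = E c p" "card B = n" by (rule E_basis)
  obtain \<beta> where \<beta>: "bij_betw \<beta> {..<n} B"
    using ex_bij_betw_nat_finite[OF B(1)] B(4) by (auto simp: atLeast0LessThan)
  have \<beta>E: "\<beta> i \<in> E c p" if "i < n" for i
    using \<beta> that B(3) span_base[of "\<beta> i" B] by (auto simp: bij_betw_def)
  have "\<exists>V. smooth_vf A V \<and> V p = \<beta> i" if "i < n" for i
    using tangent_extension[of "\<beta> i" p] \<beta>E[OF that] by (auto simp: E_iff)
  then obtain V where V: "\<And>i. i < n \<Longrightarrow> smooth_vf A (V i)" "\<And>i. i < n \<Longrightarrow> V i p = \<beta> i" by metis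
  define X where "X i = (1/2) *\<^sub>R (app Q (app Q (V i)) + c *\<^sub>R app Q (V i))" for i
  have smooth_Q: "smooth_vf A (app Q Y)" if "smooth_vf A Y" for Y
    using Q_smooth that unfolding smooth_endo_def by blast
  have sX: "smooth_vf A (X i)" if "i < n" for i
    using V(1)[OF that] by (simp add: X_def smooth_Q)
  have XE: "X i q \<in> E c q" if "i < n" for i q
    using E_projection(1)[of "V i q" q] V(1)[OF that] by (simp add: X_def)
  have Xp: "X i p = \<beta> i" if "i < n" for i
    using V(2)[OF that] \<beta>E[OF that] scaleR_half_double[of "\<beta> i"] by (simp add: X_def E_iff)
  have "\<exists>f. smooth_fun A f \<and> (\<forall>i<n. X i p f = (if i = j then 1 else 0))" if j: "j < n" for j
  proof -
    obtain L :: "'a tangent \<Rightarrow> real" where L: "linear L" "\<forall>b\<in>B. L b = (if b = \<beta> j then 1 else 0)"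
      using linear_independent_extend[OF B(2), of "\<lambda>b. if b = \<beta> j then 1 else 0"] by blast
    obtain f where f: "smooth_fun A f" "\<And>v. v \<in> TM p \<Longrightarrow> v f = L v"
      using linear_functional_eq_tangent[OF L(1), of p] by blast
    have "X i p f = (if i = j then 1 else 0)" if i: "i < n" for i
    proof -
      have "X i p f = L (\<beta> i)" using f(2) Xp[OF i] sX[OF i] smooth_vf_tangent by metis
      also have "\<dots> = (if i = j then 1 else 0)"
        using L(2) \<beta> i j unfolding bij_betw_def inj_on_def by auto
      finally show ?thesis .
    qed
    then show ?thesis using f(1) by blast
  qed
  then obtain f where f: "\<And>j. j < n \<Longrightarrow> smooth_fun A (f j)"
    "\<And>i j. i < n \<Longrightarrow> j < n \<Longrightarrow> X i p (f j) = (if i = j then 1 else 0)" by metis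
  define W where "W = (\<Inter>i\<in>{..<n}. \<Inter>j\<in>{..<n}.
     {q. \<bar>X i q (f j) - (if i = j then 1 else 0)\<bar> < 1 / (real n + 1)})"
  have "open W"
    unfolding W_def
  proof (intro open_INT finite_lessThan ballI open_Collect_less)
    fix i j assume "i \<in> {..<n}" "j \<in> {..<n}"
    then show "continuous_on UNIV (\<lambda>q. \<bar>X i q (f j) - (if i = j then 1 else 0)\<bar>)"
      using smooth_fun_continuous[OF smooth_vf_smooth_fun[OF sX f(1)]]
      by (intro continuous_intros) auto
  qed simp
  moreover have "p \<in> W" unfolding W_def using f(2) by simp
  moreover have "inj_on (\<lambda>i. X i q) {..<n} \<and> independent ((\<lambda>i. X i q) ` {..<n}) \<and>
      span ((\<lambda>i. X i q) ` {..<n}) = E c q" if q: "q \<in> W" for q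
  proof -
    have *: "inj_on (\<lambda>i. X i q) {..<n}" "independent ((\<lambda>i. X i q) ` {..<n})"
      using near_dual_family_independent[of n "\<lambda>i. X i q" f] q unfolding W_def by auto
    obtain C where C: "finite C" "span C = E c q" "card C = n" by (rule E_basis[of q]) (rule that)
    have "span ((\<lambda>i. X i q) ` {..<n}) = span C"
      using * XE C card_image[OF *(1)] by (intro span_eq_if_card_eq) auto
    then show ?thesis using * C by simp
  qed
  ultimately show "\<exists>W X. open W \<and> p \<in> W \<and> (\<forall>i<n. smooth_vf A (X i)) \<and>
     (\<forall>q\<in>W. inj_on (\<lambda>i. X i q) {..<n} \<and> independent ((\<lambda>i. X i q) ` {..<n}) \<and>
        span ((\<lambda>i. X i q) ` {..<n}) = E c q)"
    using sX by blast
qed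

lemma legendre_foliation_E:
  assumes "involutive A (E c)"
  shows "legendre_foliation A n \<eta> (E c)"
  unfolding legendre_foliation_def using subbundle_E eta_E assms by blast

end

section \<open>The standard almost bi-paracontact structure\<close>

context non_sasakian_kappa_mu
begin

definition phi1 :: "'a endo_field" where "phi1 = (1 / lam) *\<^sub>R comp_endo \<phi> h"
definition phi2 :: "'a endo_field" where "phi2 = (1 / lam) *\<^sub>R h"

lemma phi1_apply: "phi1 p v = (1 / lam) *\<^sub>R \<phi> p (h p v)"
  by (simp add: phi1_def comp_endo_def)

lemma phi2_apply: "phi2 p v = (1 / lam) *\<^sub>R h p v"
  by (simp add: phi2_def)

lemma smooth_endo_phi1: "smooth_endo A phi1" and smooth_endo_phi2: "smooth_endo A phi2"
proof -
  have f1: "app phi1 X = (1 / lam) *\<^sub>R app \<phi> (app h X)" for X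
    by (rule ext) (simp add: phi1_apply)
  have f2: "app phi2 X = (1 / lam) *\<^sub>R app h X" for X
    by (rule ext) (simp add: phi2_apply)
  show "smooth_endo A phi1"
    unfolding smooth_endo_def by (simp add: f1) (simp add: phi1_apply algebra_simps)
  show "smooth_endo A phi2"
    unfolding smooth_endo_def by (simp add: f2) (simp add: phi2_apply algebra_simps)
qed

lemma lam_cancel: "(1 / lam) * ((1 / lam) * (1 - \<kappa>)) = 1"
  using lam_pos by (simp add: lam_square[symmetric])

lemma phi_relations:
  assumes v: "v \<in> TM p"
  shows "phi1 p (phi1 p v) = v - \<eta> p v *\<^sub>R \<xi> p" "phi2 p (phi2 p v) = v - \<eta> p v *\<^sub>R \<xi> p"
    "phi1 p (phi2 p v) = - phi2 p (phi1 p v)" "\<phi> p v = phi1 p (phi2 p v)"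
    "phi1 p (\<phi> p v) = - \<phi> p (phi1 p v)" "phi2 p (\<phi> p v) = - \<phi> p (phi2 p v)"
  using v lam_cancel kappa by (simp_all add: phi1_apply phi2_apply h_h)

lemma phi_xi_zero: "phi1 p (\<xi> p) = 0" "phi2 p (\<xi> p) = 0"
  by (simp_all add: phi1_apply phi2_apply)

lemma eigendistribution_scale:
  "eigendistribution A ((1 / lam) *\<^sub>R Q) c = eigendistribution A Q (lam * c)"
proof -
  have "(1 / lam) *\<^sub>R w = c *\<^sub>R v \<longleftrightarrow> w = (lam * c) *\<^sub>R v" for v w :: "'a tangent"
  proof
    assume "(1 / lam) *\<^sub>R w = c *\<^sub>R v"
    then have "lam *\<^sub>R ((1 / lam) *\<^sub>R w) = lam *\<^sub>R (c *\<^sub>R v)" by simp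
    then show "w = (lam * c) *\<^sub>R v" using lam_pos by simp
  qed (use lam_pos in simp)
  then show ?thesis unfolding eigendistribution_def by (intro ext) simp
qed

lemma legendre_phi1:
  assumes "c \<in> {1, -1}"
  shows "legendre_foliation A n \<eta> (eigendistribution A phi1 c)"
proof -
  interpret paracontact_endo A n \<phi> \<xi> \<eta> g D phi1 c
    by unfold_locales (use assms in \<open>simp_all add: smooth_endo_phi1 phi_relations(1,5) phi_xi_zero
      del: insert_iff\<close>)
  have "involutive A (eigendistribution A phi1 c)"
    unfolding phi1_def eigendistribution_scale
    using involutive_phi_h lam_pos assms by auto
  then show ?thesis by (rule legendre_foliation_E)
qed

lemma legendre_phi2:
  assumes "c \<in> {1, -1}"
  shows "legendre_foliation A n \<eta> (eigendistribution A phi2 c)"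
proof -
  interpret paracontact_endo A n \<phi> \<xi> \<eta> g D phi2 c
    by unfold_locales (use assms in \<open>simp_all add: smooth_endo_phi2 phi_relations(2,6) phi_xi_zero
      del: insert_iff\<close>)
  have "involutive A (eigendistribution A phi2 c)"
    unfolding phi2_def eigendistribution_scale
    using involutive_h lam_pos assms by auto
  then show ?thesis by (rule legendre_foliation_E)
qed

lemma standard_phi: "standard_bi_paracontact A n \<phi> \<xi> \<eta> \<kappa> phi1 phi2 \<phi>"
proof -
  have a: "almost_bi_paracontact A \<xi> \<eta> phi1 phi2 \<phi>"
    unfolding almost_bi_paracontact_def
    by (intro conjI allI ballI smooth_endo_phi1 smooth_endo_phi2 phi_smooth phi_relations(1-4)
        phi_square)
  have "integrable_bi_paracontact A n \<xi> \<eta> phi1 phi2 \<phi>"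
    unfolding integrable_bi_paracontact_def using a legendre_phi1 legendre_phi2 by blast
  moreover have "phi1 p v = v" if "v \<in> eigendistribution A (comp_endo \<phi> h) lam p" for p v
    using that lam_pos by (simp add: eigendistribution_def phi1_apply comp_endo_def)
  moreover have "phi1 p v = - v" if "v \<in> eigendistribution A (comp_endo \<phi> h) (- lam) p" for p v
    using that lam_pos by (simp add: eigendistribution_def phi1_apply comp_endo_def)
  moreover have "phi2 p v = v" if "v \<in> eigendistribution A h lam p" for p v
    using that lam_pos by (simp add: eigendistribution_def phi2_apply)
  moreover have "phi2 p v = - v" if "v \<in> eigendistribution A h (- lam) p" for p v
    using that lam_pos by (simp add: eigendistribution_def phi2_apply)
  ultimately show ?thesis
    unfolding standard_bi_paracontact_def Let_def h_def[symmetric] lam_def[symmetric]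
    using phi_xi_zero phi_relations(4) by blast
qed

text \<open>With \<open>u = v - \<eta>(v) \<xi>\<close>, the vectors \<open>\<lambda> u + N v\<close> and \<open>\<lambda> u - N v\<close> are eigenvectors of \<open>N\<close> for \<open>\<lambda>\<close> and \<open>- \<lambda>\<close>, and \<open>v\<close> is
  a combination of them and \<open>\<xi>\<close>. So a linear map is determined by its values on the eigenspaces and \<open>\<xi>\<close>.\<close>

lemma endo_unique:
  assumes S: "smooth_endo A S"
    and N: "\<And>v. v \<in> TM p \<Longrightarrow> N p v \<in> TM p"
    and NN: "\<And>v. v \<in> TM p \<Longrightarrow> N p (N p v) = (lam * lam) *\<^sub>R (v - \<eta> p v *\<^sub>R \<xi> p)"
    and Nl: "\<And>a b v w. v \<in> TM p \<Longrightarrow> w \<in> TM p \<Longrightarrow> N p (a *\<^sub>R v + b *\<^sub>R w) = a *\<^sub>R N p v + b *\<^sub>R N p w"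
    and xi: "S p (\<xi> p) = 0" "N p (\<xi> p) = 0"
    and plus: "\<And>v. v \<in> eigendistribution A N lam p \<Longrightarrow> S p v = v"
    and minus: "\<And>v. v \<in> eigendistribution A N (- lam) p \<Longrightarrow> S p v = - v"
    and v: "v \<in> TM p"
  shows "S p v = (1 / lam) *\<^sub>R N p v"
proof -
  have Sl: "S p (a *\<^sub>R x + b *\<^sub>R y) = a *\<^sub>R S p x + b *\<^sub>R S p y"
    if "x \<in> TM p" "y \<in> TM p" for a b x y
    using S that unfolding smooth_endo_def by blast
  define u where "u = v - \<eta> p v *\<^sub>R \<xi> p"
  define x where "x = lam *\<^sub>R u + 1 *\<^sub>R N p v"
  define y where "y = lam *\<^sub>R u + (-1) *\<^sub>R N p v"
  have u: "u \<in> TM p" using v by (simp add: u_def)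
  have Nu: "N p u = N p v"
    using Nl[OF v smooth_vf_tangent[OF xi_smooth], of 1 "- \<eta> p v"] xi by (simp add: u_def)
  have Nx: "N p x = lam *\<^sub>R x" "N p y = - lam *\<^sub>R y"
    using Nl[OF u N[OF v], of lam 1] Nl[OF u N[OF v], of lam "-1"]
    unfolding x_def[symmetric] y_def[symmetric] Nu NN[OF v] u_def[symmetric]
    by (simp_all add: x_def y_def algebra_simps)
  have xy: "x \<in> TM p" "y \<in> TM p" using u v N by (simp_all add: x_def y_def)
  have Sx: "S p x = x" "S p y = - y"
    using plus[of x] minus[of y] Nx xy by (simp_all add: eigendistribution_def)
  have vxy: "u = (1 / (2 * lam)) *\<^sub>R x + (1 / (2 * lam)) *\<^sub>R y"
  proof -
    have "x + y = lam *\<^sub>R (u + u)" unfolding x_def y_def scaleR_add_right by simp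
    then have "(1 / (2 * lam)) *\<^sub>R x + (1 / (2 * lam)) *\<^sub>R y = (1 / (2 * lam)) *\<^sub>R (lam *\<^sub>R (u + u))"
      by (simp only: flip: scaleR_add_right)
    also have "\<dots> = (1/2) *\<^sub>R (u + u)"
    proof -
      have "1 / (2 * lam) * lam = 1 / 2" using lam_pos by simp
      then show ?thesis unfolding scaleR_scaleR by (simp only:)
    qed
    finally show ?thesis unfolding scaleR_half_double by (rule sym)
  qed
  have "S p v = S p u"
    using Sl[OF v smooth_vf_tangent[OF xi_smooth], of 1 "- \<eta> p v"] xi by (simp add: u_def)
  also have "\<dots> = (1 / (2 * lam)) *\<^sub>R x - (1 / (2 * lam)) *\<^sub>R y"
    using Sl[OF xy, of "1 / (2 * lam)" "1 / (2 * lam)"] Sx by (simp add: vxy[symmetric])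
  also have "\<dots> = (1 / (2 * lam)) *\<^sub>R (N p v + N p v)"
  proof -
    have "x - y = N p v + N p v" by (simp add: x_def y_def)
    then show ?thesis by (simp only: flip: scaleR_diff_right)
  qed
  also have "\<dots> = (1 / lam) *\<^sub>R ((1/2) *\<^sub>R (N p v + N p v))" by simp
  finally show ?thesis unfolding scaleR_half_double .
qed

lemma standard_unique:
  assumes "standard_bi_paracontact A n \<phi> \<xi> \<eta> \<kappa> S1 S2 S3"
  shows "endo_eq A S1 phi1" "endo_eq A S2 phi2" "endo_eq A S3 \<phi>"
proof -
  have st: "smooth_endo A S1" "smooth_endo A S2"
    "\<And>p. S1 p (\<xi> p) = 0" "\<And>p. S2 p (\<xi> p) = 0"
    "\<And>p v. v \<in> eigendistribution A (comp_endo \<phi> h) lam p \<Longrightarrow> S1 p v = v"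
    "\<And>p v. v \<in> eigendistribution A (comp_endo \<phi> h) (- lam) p \<Longrightarrow> S1 p v = - v"
    "\<And>p v. v \<in> eigendistribution A h lam p \<Longrightarrow> S2 p v = v"
    "\<And>p v. v \<in> eigendistribution A h (- lam) p \<Longrightarrow> S2 p v = - v"
    "\<And>p v. v \<in> TM p \<Longrightarrow> S3 p v = S1 p (S2 p v)"
    using assms unfolding standard_bi_paracontact_def Let_def h_def[symmetric] lam_def[symmetric]
      integrable_bi_paracontact_def almost_bi_paracontact_def by blast+
  have "S1 p v = (1 / lam) *\<^sub>R comp_endo \<phi> h p v" if v: "v \<in> TM p" for p v
    by (rule endo_unique[OF st(1), where N = "comp_endo \<phi> h"])
      (use v st(3,5,6) in \<open>simp_all add: comp_endo_def h_h lam_square algebra_simps\<close>)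
  then have 1: "S1 p v = phi1 p v" if "v \<in> TM p" for p v
    using that by (simp add: phi1_def)
  have "S2 p v = (1 / lam) *\<^sub>R h p v" if v: "v \<in> TM p" for p v
    by (rule endo_unique[OF st(2), where N = h])
      (use v st(4,7,8) in \<open>simp_all add: h_h lam_square\<close>)
  then have 2: "S2 p v = phi2 p v" if "v \<in> TM p" for p v
    using that by (simp add: phi2_def)
  show "endo_eq A S1 phi1" "endo_eq A S2 phi2" using 1 2 unfolding endo_eq_def by blast+
  have "S3 p v = \<phi> p v" if v: "v \<in> TM p" for p v
  proof -
    have "phi2 p v \<in> TM p" using v by (simp add: phi2_apply)
    then show ?thesis using st(9)[OF v] 1 2[OF v] phi_relations(4)[OF v] by simp
  qed
  then show "endo_eq A S3 \<phi>" unfolding endo_eq_def by blast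
qed

end

theorem theorem5p3:
  fixes A :: "('a::{t2_space, second_countable_topology}, 'e::euclidean_space) atlas"
    and n :: nat and \<phi> :: "'a endo_field" and \<xi> :: "'a vector_field"
    and \<eta> :: "'a one_form" and g :: "'a bilinear_field" and \<kappa> \<mu> :: real
  assumes "contact_metric_kappa_mu_space A n \<phi> \<xi> \<eta> g \<kappa> \<mu>"
    and "\<not> sasakian A \<phi> \<xi> \<eta>"
  shows "standard_bi_paracontact A n \<phi> \<xi> \<eta> \<kappa>
           ((1 / sqrt (1 - \<kappa>)) *\<^sub>R comp_endo \<phi> (h_tensor A \<phi> \<xi>))
           ((1 / sqrt (1 - \<kappa>)) *\<^sub>R h_tensor A \<phi> \<xi>)
           \<phi> \<and>
         (\<forall>\<phi>1 \<phi>2 \<phi>3. standard_bi_paracontact A n \<phi> \<xi> \<eta> \<kappa> \<phi>1 \<phi>2 \<phi>3 \<longrightarrow>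
           endo_eq A \<phi>1 ((1 / sqrt (1 - \<kappa>)) *\<^sub>R comp_endo \<phi> (h_tensor A \<phi> \<xi>)) \<and>
           endo_eq A \<phi>2 ((1 / sqrt (1 - \<kappa>)) *\<^sub>R h_tensor A \<phi> \<xi>) \<and>
           endo_eq A \<phi>3 \<phi>)"
proof -
  interpret contact_metric_kappa_mu_space A n \<phi> \<xi> \<eta> g \<kappa> \<mu> by (rule assms(1))
  obtain D where D: "levi_civita A g D"
    and curv: "\<And>X Y p. smooth_vf A X \<Longrightarrow> smooth_vf A Y \<Longrightarrow> curvature D X Y \<xi> p =
        \<kappa> *\<^sub>R (\<eta> p (Y p) *\<^sub>R X p - \<eta> p (X p) *\<^sub>R Y p) +
        \<mu> *\<^sub>R (\<eta> p (Y p) *\<^sub>R h_tensor A \<phi> \<xi> p (X p) - \<eta> p (X p) *\<^sub>R h_tensor A \<phi> \<xi> p (Y p))"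
    using kappa_mu by blast
  interpret contact_metric_connection A n \<phi> \<xi> \<eta> g D by unfold_locales (rule D)
  interpret kappa_mu_connection A n \<phi> \<xi> \<eta> g D \<kappa> \<mu>
    by unfold_locales (use curv in \<open>simp add: h_def\<close>)
  interpret non_sasakian_kappa_mu A n \<phi> \<xi> \<eta> g D \<kappa> \<mu>
    by unfold_locales (rule kappa_less_1[OF assms(2)])
  show ?thesis
    using standard_phi standard_unique unfolding phi1_def phi2_def h_def lam_def by blast
qed

end
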